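(* $\alpha_{\mathsf{RePair}}(2,n)\in\Omega\left(\log n/\log\log n\right)$. That is, there is a constant $c>0$ and infinitely many $n$ for which there is a word $w\in\{a,b\}^n$ over a two-letter alphabet with $|\mathsf{RePair}(w)|/g(w)\ge c\log n/\log\log n$.
   Context: All logarithms are to base 2. A straight-line program (SLP) is a tuple $\mathbb A=(N,\Sigma,P,S)$ where $N$ is a finite set of nonterminals disjoint from the alphabet $\Sigma$, $S\in N$ is the start nonterminal, and $P$ contains exactly one production $A\to w$ with $w\in(N\cup\Sigma)^+$ for each $A\in N$, such that the relation "$B$ occurs in the right-hand side of $A$" is acyclic. Each nonterminal derives a unique word, and $\mathrm{val}(\mathbb A)$ is the word derived from $S$. The size is $|\mathbb A|=\sum_{(A\to w)\in P}|w|$. For a nonempty word $w$, $g(w)$ is the minimum size of an SLP deriving $w$. For an SLP $\mathbb A$, a word $\gamma\in(N\cup\Sigma)^+$ is a maximal string of $\mathbb A$ if $|\gamma|\ge 2$, $\gamma$ occurs at least twice without overlap in the right-hand sides of $\mathbb A$, and no strictly longer word occurs at least as many times without overlap in the right-hand sides. The compressor $\mathsf{RePair}$ on input $w$ starts with the SLP with the single rule $S\to w$; in each round it selects a maximal string $\gamma$ with the largest number of non-overlapping occurrences, replaces a largest set of pairwise non-overlapping occurrences of $\gamma$ (chosen from left to right) in the right-hand sides by a fresh nonterminal $X$, and adds the rule $X\to\gamma$. It stops when no maximal string exists; $\mathsf{RePair}(w)$ denotes the resulting SLP. The approximation ratio is $\alpha_{\mathsf{RePair}}(w)=|\mathsf{RePair}(w)|/g(w)$,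 and $\alpha_{\mathsf{RePair}}(k,n)=\max\{\alpha_{\mathsf{RePair}}(w)\mid w\in[1,k]^n\}$, the maximum over all words of length $n$ over a $k$-letter alphabet. *)

theory Defs
  imports Complex_Main
begin

text \<open>Symbols of an SLP: terminals (letters, natural numbers; the alphabet [1,k]
  is the set {1..k}) and nonterminals (named by natural numbers).\<close>
datatype sym = T nat | N nat

type_synonym grammar = "nat \<rightharpoonup> sym list"

definition is_slp :: "grammar \<Rightarrow> nat \<Rightarrow> bool" where
  "is_slp P S \<longleftrightarrow> finite (dom P) \<and> S \<in> dom P
     \<and> (\<forall>A rhs. P A = Some rhs \<longrightarrow> rhs \<noteq> [] \<and> (\<forall>B. N B \<in> set rhs \<longrightarrow> B \<in> dom P))
     \<and> acyclic {(A, B). \<exists>rhs. P A = Some rhs \<and> N B \<in> set rhs}"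

inductive derives :: "grammar \<Rightarrow> sym \<Rightarrow> nat list \<Rightarrow> bool"
  and derives_list :: "grammar \<Rightarrow> sym list \<Rightarrow> nat list \<Rightarrow> bool" for P where
  der_T: "derives P (T a) [a]"
| der_N: "P A = Some rhs \<Longrightarrow> derives_list P rhs w \<Longrightarrow> derives P (N A) w"
| derl_Nil: "derives_list P [] []"
| derl_Cons: "derives P s u \<Longrightarrow> derives_list P ss v \<Longrightarrow> derives_list P (s # ss) (u @ v)"

definition slp_size :: "grammar \<Rightarrow> nat" where
  "slp_size P = (\<Sum>A\<in>dom P. length (the (P A)))"

definition g :: "nat list \<Rightarrow> nat" where
  "g w = (LEAST s. \<exists>P S. is_slp P S \<and> derives P (N S) w \<and> slp_size P = s)"

text \<open>Greedy left-to-right count of non-overlapping occurrences of gm in xs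
  (this equals the maximum number of pairwise non-overlapping occurrences).\<close>
function cnt :: "sym list \<Rightarrow> sym list \<Rightarrow> nat" where
  "cnt gm [] = 0"
| "cnt gm (x # xs) = (if gm \<noteq> [] \<and> take (length gm) (x # xs) = gm
      then Suc (cnt gm (drop (length gm - 1) xs)) else cnt gm xs)"
  by pat_completeness auto
termination by (relation "measure (\<lambda>(gm, xs). length xs)") auto

function repl :: "sym list \<Rightarrow> sym \<Rightarrow> sym list \<Rightarrow> sym list" where
  "repl gm X [] = []"
| "repl gm X (x # xs) = (if gm \<noteq> [] \<and> take (length gm) (x # xs) = gm
      then X # repl gm X (drop (length gm - 1) xs) else x # repl gm X xs)"
  by pat_completeness auto
termination by (relation "measure (\<lambda>(gm, X, xs). length xs)") auto

definition occ :: "grammar \<Rightarrow> sym list \<Rightarrow> nat" where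
  "occ P gm = (\<Sum>A\<in>dom P. cnt gm (the (P A)))"

definition maximal_string :: "grammar \<Rightarrow> sym list \<Rightarrow> bool" where
  "maximal_string P gm \<longleftrightarrow> length gm \<ge> 2 \<and> occ P gm \<ge> 2
     \<and> \<not> (\<exists>d. length d > length gm \<and> occ P d \<ge> occ P gm)"

definition repair_step :: "grammar \<Rightarrow> grammar \<Rightarrow> bool" where
  "repair_step P P' \<longleftrightarrow> (\<exists>gm X. maximal_string P gm
     \<and> (\<forall>d. maximal_string P d \<longrightarrow> occ P d \<le> occ P gm)
     \<and> X \<notin> dom P
     \<and> P' = (\<lambda>A. map_option (repl gm (N X)) (P A))(X \<mapsto> gm))"

definition repair_result :: "nat list \<Rightarrow> grammar \<Rightarrow> bool" where
  "repair_result w P \<longleftrightarrow> repair_step\<^sup>*\<^sup>* [0 \<mapsto> map T w] P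
     \<and> \<not> (\<exists>gm. maximal_string P gm)"

end

theory Submission
  imports Defs "HOL-Library.Sublist" "HOL-Library.Infinite_Set"
begin

text \<open>The word consists of blocks \<open>1\<^sup>v 2\<close>, where \<open>v\<close> runs through the values of the binary numerals
  \<open>1 \<beta>\<^sub>0 \<dots> \<beta>\<^sub>p\<^sub>-\<^sub>1\<close> with \<open>J < p \<le> 2 J\<close>, for a fixed bit sequence \<open>\<beta>\<close>. Consecutive values satisfy
  \<open>v' = 2 v + b\<close>, so an SLP of size \<open>O(J)\<close> exists. RePair, in contrast, spends its first \<open>J\<close> rounds on
  \<open>X\<^sub>i\<^sub>+\<^sub>1 \<rightarrow> X\<^sub>i X\<^sub>i\<close>, which spells out the low \<open>J\<close> binary digits of every \<open>v\<close> as a product of the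
  \<open>X\<^sub>i\<close> with \<open>i < J\<close>. From one block to the next these products are shifted by one index. Windows of
  \<open>\<beta>\<close> of length of order \<open>log J\<close> determine their position, hence so do windows of such products.
  Every later rule abbreviates a word that occurs twice, so it cannot swallow a window, and the start
  rule keeps a length of order \<open>J\<^sup>2 / log J\<close>.\<close>

section \<open>Counting and replacing occurrences\<close>

lemma take_eq_imp_split:
  assumes "gm \<noteq> []" "take (length gm) (x # xs) = gm"
  shows "x # xs = gm @ drop (length gm - 1) xs"
proof -
  have "x # xs = gm @ drop (length gm) (x # xs)"
    using assms(2) by (metis append_take_drop_id)
  then show ?thesis using assms(1) by (cases gm) auto
qed

lemma length_repl:
  "length (repl gm X xs) + cnt gm xs * (length gm - 1) = length xs"
proof (induction gm xs rule: cnt.induct)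
  case (2 gm x xs)
  show ?case
  proof (cases "gm \<noteq> [] \<and> take (length gm) (x # xs) = gm")
    case True
    then have "length (x # xs) = length (gm @ drop (length gm - 1) xs)"
      using take_eq_imp_split by metis
    moreover from True have "length gm \<ge> 1" by (cases gm) auto
    ultimately show ?thesis using True 2(1) by auto
  qed (use 2(2) in auto)
qed simp

lemma cnt_eq_0_imp_repl_id: "cnt gm xs = 0 \<Longrightarrow> repl gm X xs = xs"
  by (induction gm xs rule: cnt.induct) (auto split: if_splits)

lemma repl_eq_Nil_iff [simp]: "repl gm X xs = [] \<longleftrightarrow> xs = []"
  by (cases xs) auto

lemma set_repl_subset: "set (repl gm X xs) \<subseteq> insert X (set xs)"
  by (induction gm xs rule: cnt.induct) (auto dest: in_set_dropD)

lemma concat_map_repl: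
  assumes "e X = concat (map e gm)"
  shows "concat (map e (repl gm X xs)) = concat (map e xs)"
  using assms
proof (induction gm xs rule: cnt.induct)
  case (2 gm x xs)
  show ?case
  proof (cases "gm \<noteq> [] \<and> take (length gm) (x # xs) = gm")
    case True
    then have "x # xs = gm @ drop (length gm - 1) xs" using take_eq_imp_split by metis
    then have "concat (map e (x # xs)) = concat (map e gm) @ concat (map e (drop (length gm - 1) xs))"
      by (metis concat_append map_append)
    then show ?thesis using True 2 by auto
  qed (use 2 in auto)
qed simp

lemma cnt_pos_imp_sublist: "cnt gm xs \<ge> 1 \<Longrightarrow> \<exists>p s. xs = p @ gm @ s"
proof (induction gm xs rule: cnt.induct)
  case (2 gm x xs)
  show ?case
  proof (cases "gm \<noteq> [] \<and> take (length gm) (x # xs) = gm")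
    case True
    then show ?thesis using take_eq_imp_split by (metis append_Nil)
  next
    case False
    then obtain p s where "xs = p @ gm @ s" using 2 by auto
    then show ?thesis by (metis append_Cons)
  qed
qed simp

lemma cnt_ge_2_imp_split: "cnt gm xs \<ge> 2 \<Longrightarrow> \<exists>p m s. xs = p @ gm @ m @ gm @ s"
proof (induction gm xs rule: cnt.induct)
  case (2 gm x xs)
  show ?case
  proof (cases "gm \<noteq> [] \<and> take (length gm) (x # xs) = gm")
    case True
    then have "cnt gm (drop (length gm - 1) xs) \<ge> 1" using 2(3) by auto
    then obtain p s where "drop (length gm - 1) xs = p @ gm @ s" using cnt_pos_imp_sublist by blast
    then show ?thesis using True take_eq_imp_split by (metis append_Nil)
  next
    case False
    then obtain p m s where "xs = p @ gm @ m @ gm @ s" using 2 by auto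
    then show ?thesis by (metis append_Cons)
  qed
qed simp

text \<open>Disjoint occurrences of \<open>d\<close> use disjoint sets of positions. Varying
  \<open>Q\<close> bounds counts by length, by the copies of one letter, or by the letters different
  from it.\<close>

lemma cnt_mult_filter_le:
  "cnt d xs * length (filter Q d) \<le> length (filter Q xs)"
proof (induction d xs rule: cnt.induct)
  case (2 gm x xs)
  show ?case
  proof (cases "gm \<noteq> [] \<and> take (length gm) (x # xs) = gm")
    case True
    then have "length (filter Q (x # xs)) = length (filter Q (gm @ drop (length gm - 1) xs))"
      using take_eq_imp_split by metis
    then show ?thesis using True 2(1) by auto
  qed (use 2(2) in auto)
qed simp

text \<open>Pairing leaves over at most one \<open>x\<close> in each maximal run of
  \<open>x\<close>, and the number of runs exceeds the number of other letters by at most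
  one.\<close>

lemma filter_le_cnt_pair:
  "length (filter (\<lambda>y. y = x) xs) \<le> 2 * cnt [x, x] xs + length (filter (\<lambda>y. y \<noteq> x) xs) + 1"
proof (induction xs rule: length_induct)
  case (1 xs)
  show ?case
  proof (cases xs)
    case (Cons y ys)
    show ?thesis
    proof (cases "y = x")
      case True
      show ?thesis
      proof (cases ys)
        case (Cons z zs)
        have "length zs < length xs" using \<open>xs = y # ys\<close> Cons by simp
        then show ?thesis using 1 \<open>xs = y # ys\<close> Cons True
          by (cases "z = x") (fastforce split: if_splits)+
      qed (use Cons True in auto)
    next
      case False
      then show ?thesis using 1 Cons by fastforce
    qed
  qed simp
qed

lemma cnt_le_length: "length gm \<ge> 1 \<Longrightarrow> cnt gm xs \<le> length xs"
  using cnt_mult_filter_le[of gm xs "\<lambda>_. True"]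
  by (auto elim: order_trans[rotated])

section \<open>RePair terminates\<close>

lemma occ_le_size: "length d \<ge> 2 \<Longrightarrow> occ P d \<le> slp_size P"
  unfolding occ_def slp_size_def by (intro sum_mono cnt_le_length) auto

definition wf_rules :: "grammar \<Rightarrow> bool" where
  "wf_rules P \<longleftrightarrow> finite (dom P) \<and> (\<forall>A\<in>dom P. the (P A) \<noteq> [])"

lemma repair_stepE:
  assumes "repair_step P P'"
  obtains gm X where "length gm \<ge> 2" "occ P gm \<ge> 2"
    "\<And>d. maximal_string P d \<Longrightarrow> occ P d \<le> occ P gm" "X \<notin> dom P"
    "P' = (\<lambda>A. map_option (repl gm (N X)) (P A))(X \<mapsto> gm)"
  using assms unfolding repair_step_def maximal_string_def by blast

lemma dom_repl_upd: "dom ((\<lambda>A. map_option (repl gm Y) (P A))(X \<mapsto> gm)) = insert X (dom P)"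
  by (auto simp: dom_def)

text \<open>With \<open>k >= 2\<close> occurrences of a word of length \<open>l >= 2\<close>, the
  replacement saves \<open>k * (l - 1) >= 2 * (l - 1) >= l\<close>, which pays for the new rule of
  length \<open>l\<close>.\<close>

lemma repair_step_size:
  assumes "repair_step P P'" "wf_rules P"
  shows "wf_rules P'" "slp_size P' \<le> slp_size P" "card (dom P') = Suc (card (dom P))"
proof -
  from assms(1) obtain gm X where gm: "length gm \<ge> 2" "occ P gm \<ge> 2" and X: "X \<notin> dom P"
    and P': "P' = (\<lambda>A. map_option (repl gm (N X)) (P A))(X \<mapsto> gm)"
    by (elim repair_stepE)
  have fin: "finite (dom P)" using assms(2) by (simp add: wf_rules_def)
  have dom: "dom P' = insert X (dom P)" using P' dom_repl_upd by simp
  show "card (dom P') = Suc (card (dom P))" using dom X fin by simp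
  have old: "the (P' A) = repl gm (N X) (the (P A))" if "A \<in> dom P" for A
    using that X by (auto simp: P')
  have new: "the (P' X) = gm" by (simp add: P')
  show "wf_rules P'"
    unfolding wf_rules_def dom using assms(2) old new gm(1)
    by (auto simp: wf_rules_def)
  have "slp_size P = (\<Sum>A\<in>dom P. length (the (P' A)) + cnt gm (the (P A)) * (length gm - 1))"
    unfolding slp_size_def by (intro sum.cong refl) (simp only: old length_repl)
  also have "\<dots> = (\<Sum>A\<in>dom P. length (the (P' A))) + occ P gm * (length gm - 1)"
    by (simp add: sum.distrib occ_def sum_distrib_right)
  finally have "slp_size P = (\<Sum>A\<in>dom P. length (the (P' A))) + occ P gm * (length gm - 1)" .
  moreover have "slp_size P' = length gm + (\<Sum>A\<in>dom P. length (the (P' A)))"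
    unfolding slp_size_def dom using X fin new by simp
  moreover have "occ P gm * (length gm - 1) \<ge> 2 * (length gm - 1)" using gm(2) by simp
  then have "occ P gm * (length gm - 1) \<ge> length gm" using gm(1) by linarith
  ultimately show "slp_size P' \<le> slp_size P" by linarith
qed

lemma card_dom_le_size: "wf_rules P \<Longrightarrow> card (dom P) \<le> slp_size P"
proof -
  assume "wf_rules P"
  then have "(\<Sum>A\<in>dom P. 1) \<le> slp_size P"
    unfolding slp_size_def wf_rules_def by (intro sum_mono) (auto simp: Suc_le_eq)
  then show ?thesis by simp
qed

lemma ex_repair_step:
  assumes "finite (dom P)" "maximal_string P d"
  shows "\<exists>P'. repair_step P P'"
proof -
  have "\<exists>gm. maximal_string P gm \<and> (\<forall>d. maximal_string P d \<longrightarrow> occ P d \<le> occ P gm)"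
    using ex_has_greatest_nat[of "maximal_string P" d "occ P" "Suc (slp_size P)"]
      assms(2) occ_le_size unfolding maximal_string_def by (metis le_imp_less_Suc)
  moreover obtain X where "X \<notin> dom P" using assms(1) ex_new_if_finite[of "dom P"] by auto
  ultimately show ?thesis unfolding repair_step_def by blast
qed

text \<open>The measure is \<open>slp_size P - card (dom P)\<close>: the size never grows, each
  round adds a rule, and nonempty rules keep the number of rules below the size.\<close>

lemma repair_terminates:
  assumes "wf_rules P"
  shows "\<exists>P'. repair_step\<^sup>*\<^sup>* P P' \<and> \<not> (\<exists>gm. maximal_string P' gm)"
  using assms
proof (induction "slp_size P - card (dom P)" arbitrary: P rule: less_induct)
  case less
  show ?case
  proof (cases "\<exists>gm. maximal_string P gm")
    case True
    then obtain P' where step: "repair_step P P'"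
      using ex_repair_step less.prems wf_rules_def by blast
    note P' = repair_step_size[OF step less.prems]
    have "slp_size P' - card (dom P') < slp_size P - card (dom P)"
      using P' card_dom_le_size[OF P'(1)] by linarith
    with less.hyps P'(1) step show ?thesis by (meson converse_rtranclp_into_rtranclp)
  qed blast
qed

section \<open>Rules added by RePair expand to repeated factors\<close>

definition occurs_twice :: "'a list \<Rightarrow> 'a list \<Rightarrow> bool" where
  "occurs_twice R z \<longleftrightarrow> (\<exists>p s p' s'. R = p @ z @ s \<and> R = p' @ z @ s' \<and> length p \<noteq> length p')"

lemma occurs_twice_sublist:
  assumes "occurs_twice R z" "sublist w z"
  shows "occurs_twice R w"
proof -
  obtain p s p' s' where R: "R = p @ z @ s" "R = p' @ z @ s'" "length p \<noteq> length p'"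
    using assms(1) unfolding occurs_twice_def by blast
  obtain a b where "z = a @ w @ b" using assms(2) by (auto simp: sublist_def)
  with R have "R = (p @ a) @ w @ (b @ s)" "R = (p' @ a) @ w @ (b @ s')"
    "length (p @ a) \<noteq> length (p' @ a)" by auto
  then show ?thesis unfolding occurs_twice_def by blast
qed

lemma occurs_twice_in_sublist:
  assumes "occurs_twice x z" "sublist x R"
  shows "occurs_twice R z"
proof -
  obtain p s p' s' where x: "x = p @ z @ s" "x = p' @ z @ s'" "length p \<noteq> length p'"
    using assms(1) unfolding occurs_twice_def by blast
  obtain a b where "R = a @ x @ b" using assms(2) by (auto simp: sublist_def)
  then have "R = (a @ p) @ z @ (s @ b)" "R = (a @ p') @ z @ (s' @ b)"
    by (simp add: x(1), simp add: x(2))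
  moreover have "length (a @ p) \<noteq> length (a @ p')" using x(3) by simp
  ultimately show ?thesis unfolding occurs_twice_def by blast
qed

text \<open>Guarantees that a name outside \<open>dom P\<close> occurs in no right-hand side, so
  that a fresh nonterminal is new to the rules as well.\<close>

definition closed_rules :: "grammar \<Rightarrow> bool" where
  "closed_rules P \<longleftrightarrow> (\<forall>A\<in>dom P. \<forall>B. N B \<in> set (the (P A)) \<longrightarrow> B \<in> dom P)"

lemma occ_ge_2_cases:
  assumes "finite (dom P)" "occ P gm \<ge> 2"
  obtains A where "A \<in> dom P" "cnt gm (the (P A)) \<ge> 2"
  | A B where "A \<in> dom P" "B \<in> dom P" "A \<noteq> B" "cnt gm (the (P A)) \<ge> 1" "cnt gm (the (P B)) \<ge> 1"
proof -
  let ?c = "\<lambda>A. cnt gm (the (P A))"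
  have "\<exists>A\<in>dom P. ?c A \<ge> 1"
  proof (rule ccontr)
    assume "\<not> ?thesis"
    then have "occ P gm = 0" unfolding occ_def by (intro sum.neutral) (auto simp: not_less_eq_eq)
    then show False using assms(2) by simp
  qed
  then obtain A where A: "A \<in> dom P" "?c A \<ge> 1" by blast
  have "occ P gm = ?c A + sum ?c (dom P - {A})"
    unfolding occ_def using A assms(1) by (simp add: sum.remove)
  show thesis
  proof (cases "?c A \<ge> 2")
    case False
    then have "sum ?c (dom P - {A}) \<noteq> 0"
      using \<open>occ P gm = _\<close> assms(2) by linarith
    then obtain B where "B \<in> dom P - {A}" "?c B \<noteq> 0" by (meson sum.neutral)
    then show thesis using that(2)[of A B] A by auto
  qed (use that A in blast)
qed

text \<open>\<open>P\<close> is the grammar reached after the forced rounds. Its rules other than the start rule are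
  too short and too different from each other to take part in any further replacement.\<close>

locale inert_rules =
  fixes P :: grammar and R :: "sym list"
  assumes start: "P 0 = Some R"
    and fin: "finite (dom P)"
    and closed: "closed_rules P"
    and len2: "A \<in> dom P - {0} \<Longrightarrow> length (the (P A)) = 2"
    and inj: "inj_on (\<lambda>A. the (P A)) (dom P - {0})"
    and no_sublist: "A \<in> dom P - {0} \<Longrightarrow> \<not> sublist (the (P A)) R"
begin

text \<open>The map \<open>e\<close> undoes exactly the rules added after \<open>P\<close>; the
  nonterminals of \<open>P\<close> stay atomic. Expanded words are therefore comparable with
  \<open>R\<close>, in which these nonterminals are letters.\<close>

definition expansion :: "grammar \<Rightarrow> (sym \<Rightarrow> sym list) \<Rightarrow> bool" where
  "expansion Q e \<longleftrightarrow> (\<forall>s. e s \<noteq> []) \<and> (\<forall>s. s \<notin> N ` (dom Q - dom P) \<longrightarrow> e s = [s])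
     \<and> concat (map e (the (Q 0))) = R
     \<and> (\<forall>Y\<in>dom Q - dom P. concat (map e (the (Q Y))) = e (N Y) \<and> occurs_twice R (e (N Y)))"

definition refines :: "grammar \<Rightarrow> bool" where
  "refines Q \<longleftrightarrow> finite (dom Q) \<and> dom P \<subseteq> dom Q \<and> closed_rules Q
     \<and> (\<forall>A\<in>dom P - {0}. Q A = P A) \<and> (\<exists>e. expansion Q e)"

lemma refines_refl: "refines P"
proof -
  have "expansion P (\<lambda>s. [s])" unfolding expansion_def using start by simp
  then show ?thesis unfolding refines_def using fin closed by blast
qed

section \<open>One further round preserves the invariant\<close>

context
  fixes Q gm e
  assumes Q: "refines Q" and e: "expansion Q e"
    and gm: "length gm \<ge> 2" "occ Q gm \<ge> 2"
begin

lemma expansion_in_R: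
  assumes "A \<in> dom Q" "A \<notin> dom P - {0}"
  shows "sublist (concat (map e (the (Q A)))) R"
proof (cases "A = 0")
  case True
  then show ?thesis using e by (simp add: expansion_def)
next
  case False
  then have "A \<in> dom Q - dom P" using assms by blast
  then have "concat (map e (the (Q A))) = e (N A)" "occurs_twice R (e (N A))"
    using e by (simp_all add: expansion_def)
  then show ?thesis by (auto simp: occurs_twice_def sublist_def)
qed

lemma expand_inert:
  assumes "A \<in> dom P - {0}"
  shows "concat (map e (the (P A))) = the (P A)"
proof -
  have "e s = [s]" if "s \<in> set (the (P A))" for s
  proof (cases s)
    case (N B)
    then have "B \<in> dom P" using that closed assms unfolding closed_rules_def by blast
    then have "s \<notin> N ` (dom Q - dom P)" using N by blast
    then show ?thesis using e unfolding expansion_def by blast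
  qed (use e in \<open>auto simp: expansion_def\<close>)
  then have "map e (the (P A)) = map (\<lambda>s. [s]) (the (P A))" by (intro map_cong) auto
  then show ?thesis by (simp only: concat_map_singleton) simp
qed

text \<open>The right-hand side has length two and \<open>gm\<close> at least two, so an occurrence
  fills it completely.\<close>

lemma inert_occurrence:
  assumes A: "A \<in> dom P - {0}" and c: "cnt gm (the (Q A)) \<ge> 1"
  shows "gm = the (P A)" "\<not> cnt gm (the (Q A)) \<ge> 2"
proof -
  have QA: "Q A = P A" using Q A by (simp add: refines_def)
  from c obtain p s where ps: "the (P A) = p @ gm @ s" using cnt_pos_imp_sublist QA by metis
  have "length (the (P A)) = 2" using len2 A by blast
  with ps gm(1) have "length p = 0 \<and> length s = 0" by (simp only: length_append) linarith
  then have "p = []" "s = []" by simp_all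
  then show eq: "gm = the (P A)" using ps by simp
  show "\<not> cnt gm (the (Q A)) \<ge> 2"
  proof
    assume "cnt gm (the (Q A)) \<ge> 2"
    then obtain p m s where "the (P A) = p @ gm @ m @ gm @ s" using cnt_ge_2_imp_split QA by metis
    then have "length (the (P A)) \<ge> 4" using gm(1) by simp
    then show False using \<open>length (the (P A)) = 2\<close> by simp
  qed
qed

text \<open>Since \<open>gm\<close> would be the whole right-hand side, another rule would have to
  contain it as well. An inert one contradicts \<open>inj\<close>; any other one expands into
  \<open>R\<close> and makes the right-hand side a factor of \<open>R\<close>, contradicting
  \<open>no_sublist\<close>.\<close>

lemma cnt_inert:
  assumes A: "A \<in> dom P - {0}"
  shows "cnt gm (the (Q A)) = 0"
proof (rule ccontr)
  assume "cnt gm (the (Q A)) \<noteq> 0"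
  then have c: "cnt gm (the (Q A)) \<ge> 1" by simp
  note gm_eq = inert_occurrence[OF A c]
  have "\<exists>B\<in>dom Q. B \<noteq> A \<and> cnt gm (the (Q B)) \<ge> 1"
  proof (rule occ_ge_2_cases[of Q gm])
    show "finite (dom Q)" using Q by (simp add: refines_def)
  next
    fix A' assume A': "A' \<in> dom Q" "2 \<le> cnt gm (the (Q A'))"
    then have "A' \<noteq> A" using gm_eq(2) by blast
    moreover have "cnt gm (the (Q A')) \<ge> 1" using A'(2) by linarith
    ultimately show ?thesis using A'(1) by blast
  next
    fix A' B' assume "A' \<in> dom Q" "B' \<in> dom Q" "A' \<noteq> B'" "1 \<le> cnt gm (the (Q A'))" "1 \<le> cnt gm (the (Q B'))"
    then show ?thesis by metis
  qed (use gm in simp)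
  then obtain B where B: "B \<in> dom Q" "B \<noteq> A" "cnt gm (the (Q B)) \<ge> 1" by blast
  show False
  proof (cases "B \<in> dom P - {0}")
    case True
    then have "gm = the (P B)" using inert_occurrence B by blast
    then show False using gm_eq inj A True B(2) by (auto dest: inj_onD)
  next
    case False
    obtain p s where "the (Q B) = p @ gm @ s" using cnt_pos_imp_sublist B by blast
    then have "sublist (concat (map e gm)) (concat (map e (the (Q B))))"
      by (auto simp: sublist_def)
    then have "sublist (concat (map e gm)) R"
      using expansion_in_R[OF B(1) False] sublist_order.order_trans by blast
    then show False using no_sublist[OF A] expand_inert[OF A] gm_eq(1) by simp
  qed
qed

text \<open>No occurrence lies in an inert rule. If one lies in an added rule, the expansion of
  \<open>gm\<close> is a factor of a word that already occurs twice; otherwise both lie in the start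
  rule, which expands to \<open>R\<close>.\<close>

lemma occurs_twice_expand: "occurs_twice R (concat (map e gm))"
proof -
  let ?E = "\<lambda>xs. concat (map e xs)"
  \<comment> \<open>Images are nonempty, so two disjoint occurrences of \<open>gm\<close> in one
    rule start at different positions after expansion.\<close>
  have ne: "?E xs \<noteq> []" if "xs \<noteq> []" for xs
    using e that by (cases xs) (auto simp: expansion_def)
  have "gm \<noteq> []" using gm(1) by auto
  then have gm_ne: "?E gm \<noteq> []" by (rule ne)
  have not_inert: "A \<notin> dom P - {0}" if "A \<in> dom Q" "cnt gm (the (Q A)) \<ge> 1" for A
  proof
    assume "A \<in> dom P - {0}"
    then have "cnt gm (the (Q A)) = 0" by (rule cnt_inert)
    with that(2) show False by simp
  qed
  have twice: "occurs_twice R (?E gm)"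
    if A: "A \<in> dom Q - dom P" and c: "cnt gm (the (Q A)) \<ge> 1" for A
  proof -
    have "?E (the (Q A)) = e (N A)" "occurs_twice R (e (N A))"
      using e A by (simp_all add: expansion_def)
    moreover obtain p s where "the (Q A) = p @ gm @ s" using cnt_pos_imp_sublist c by blast
    then have "sublist (?E gm) (?E (the (Q A)))" by (auto simp: sublist_def)
    ultimately show ?thesis using occurs_twice_sublist by metis
  qed
  show ?thesis
  proof (rule occ_ge_2_cases[of Q gm])
    show "finite (dom Q)" using Q by (simp add: refines_def)
  next
    fix A assume A: "A \<in> dom Q" "2 \<le> cnt gm (the (Q A))"
    then obtain p m s where "the (Q A) = p @ gm @ m @ gm @ s" using cnt_ge_2_imp_split by blast
    then have "?E (the (Q A)) = ?E p @ ?E gm @ (?E m @ ?E gm @ ?E s)"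
      "?E (the (Q A)) = (?E p @ ?E gm @ ?E m) @ ?E gm @ ?E s" by simp_all
    moreover have "length (?E p) \<noteq> length (?E p @ ?E gm @ ?E m)" using gm_ne by simp
    ultimately have "occurs_twice (?E (the (Q A))) (?E gm)" unfolding occurs_twice_def by blast
    moreover have "A \<notin> dom P - {0}" using not_inert A by simp
    ultimately show ?thesis using occurs_twice_in_sublist expansion_in_R A(1) by blast
  next
    fix A B assume *: "A \<in> dom Q" "B \<in> dom Q" "A \<noteq> B" "1 \<le> cnt gm (the (Q A))" "1 \<le> cnt gm (the (Q B))"
    then have "A \<in> dom Q - dom P \<or> B \<in> dom Q - dom P" using not_inert by blast
    then show ?thesis using twice * by blast
  qed (use gm in simp)
qed

lemma refines_replace:
  assumes X: "X \<notin> dom Q"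
  shows "refines ((\<lambda>A. map_option (repl gm (N X)) (Q A))(X \<mapsto> gm))" (is "refines ?Q'")
proof -
  have dom: "dom ?Q' = insert X (dom Q)" by (rule dom_repl_upd)
  have PQ: "dom P \<subseteq> dom Q" and finQ: "finite (dom Q)" and cQ: "closed_rules Q"
    and QP: "\<And>A. A \<in> dom P - {0} \<Longrightarrow> Q A = P A"
    using Q by (auto simp: refines_def)
  have zero: "0 \<in> dom Q" using start PQ by auto
  have old: "the (?Q' A) = repl gm (N X) (the (Q A))" if "A \<in> dom Q" for A
    using that X by auto
  have gm_sub: "\<exists>A\<in>dom Q. set gm \<subseteq> set (the (Q A))"
  proof -
    have "\<exists>A\<in>dom Q. cnt gm (the (Q A)) \<ge> 1"
      by (rule occ_ge_2_cases[OF finQ gm(2)]) (meson one_le_numeral order_trans, blast)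
    then obtain A where "A \<in> dom Q" "cnt gm (the (Q A)) \<ge> 1" by blast
    moreover from this obtain p s where "the (Q A) = p @ gm @ s" using cnt_pos_imp_sublist by blast
    ultimately show ?thesis by (intro bexI[of _ A]) auto
  qed
  \<comment> \<open>The fresh symbol is expanded through its own rule; no other image changes,
    because \<open>N X\<close> occurs in no rule of \<open>Q\<close> and not in
    \<open>gm\<close>.\<close>
  let ?e = "e(N X := concat (map e gm))"
  have same: "map ?e xs = map e xs" if "N X \<notin> set xs" for xs using that by auto
  have X_notin: "N X \<notin> set (the (Q A))" if "A \<in> dom Q" for A
    using that cQ X by (auto simp: closed_rules_def)
  have X_gm: "N X \<notin> set gm" using gm_sub X_notin by blast
  have expd: "concat (map ?e (the (?Q' A))) = concat (map e (the (Q A)))" if "A \<in> dom Q" for A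
  proof -
    have "?e (N X) = concat (map ?e gm)" unfolding same[OF X_gm] by simp
    then show ?thesis unfolding old[OF that] using concat_map_repl same[OF X_notin[OF that]] by metis
  qed
  have "gm \<noteq> []" using gm(1) by auto
  then have "expansion ?Q' ?e"
    unfolding expansion_def dom
  proof (intro conjI allI ballI impI)
    fix s show "?e s \<noteq> []" using e \<open>gm \<noteq> []\<close> by (cases gm) (auto simp: expansion_def)
  next
    fix s assume "s \<notin> N ` (insert X (dom Q) - dom P)"
    then have "s \<notin> N ` (dom Q - dom P)" "s \<noteq> N X" using X PQ by blast+
    then show "?e s = [s]" using e unfolding expansion_def by simp
  next
    show "concat (map ?e (the (?Q' 0))) = R" using expd[OF zero] e by (simp add: expansion_def)
  next
    fix Y assume Y: "Y \<in> insert X (dom Q) - dom P"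
    show "concat (map ?e (the (?Q' Y))) = ?e (N Y)"
    proof (cases "Y = X")
      case True
      then have "the (?Q' Y) = gm" "?e (N Y) = concat (map e gm)" by simp_all
      then show ?thesis by (simp only: same[OF X_gm])
    next
      case False then show ?thesis using Y expd[of Y] e by (simp add: expansion_def)
    qed
    show "occurs_twice R (?e (N Y))"
    proof (cases "Y = X")
      case True then show ?thesis using occurs_twice_expand by simp
    next
      case False then show ?thesis using Y e by (simp add: expansion_def)
    qed
  qed
  moreover have "closed_rules ?Q'"
    unfolding closed_rules_def dom
  proof (intro ballI allI impI)
    fix A B assume A: "A \<in> insert X (dom Q)" and B: "N B \<in> set (the (?Q' A))"
    show "B \<in> insert X (dom Q)"
    proof (cases "A = X")
      case True
      then show ?thesis using B gm_sub cQ by (auto simp: closed_rules_def)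
    next
      case False
      then have "N B \<in> insert (N X) (set (the (Q A)))"
        using A B old[of A] set_repl_subset[of gm "N X" "the (Q A)"] by auto
      then show ?thesis using False A cQ by (auto simp: closed_rules_def)
    qed
  qed
  moreover have "?Q' A = P A" if A: "A \<in> dom P - {0}" for A
  proof -
    have "A \<noteq> X" using A X PQ by auto
    moreover obtain rhs where "Q A = Some rhs" using A PQ by blast
    ultimately show ?thesis
      using cnt_inert[OF A] QP[OF A] by (simp add: cnt_eq_0_imp_repl_id)
  qed
  ultimately show ?thesis unfolding refines_def dom using finQ PQ by auto
qed

end

lemma refines_rtranclp:
  assumes "repair_step\<^sup>*\<^sup>* P Q"
  shows "refines Q"
  using assms
proof (induction rule: rtranclp_induct)
  case base
  show ?case by (rule refines_refl)
next
  case (step Q Q')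
  from step(3) obtain e where "expansion Q e" unfolding refines_def by blast
  moreover from step(2) obtain gm X where "length gm \<ge> 2" "occ Q gm \<ge> 2" "X \<notin> dom Q"
    "Q' = (\<lambda>A. map_option (repl gm (N X)) (Q A))(X \<mapsto> gm)" by (elim repair_stepE)
  ultimately show ?case using refines_replace step(3) by metis
qed

text \<open>The words \<open>zs\<close> are the images under \<open>e\<close> of the symbols in the
  start rule of \<open>Q\<close>, so there are at most \<open>slp_size Q\<close> of them.\<close>

lemma repair_start_rule:
  assumes "repair_step\<^sup>*\<^sup>* P Q"
  obtains zs where "length zs \<le> slp_size Q" "concat zs = R"
    "\<And>z. z \<in> set zs \<Longrightarrow> length z = 1 \<or> occurs_twice R z"
proof -
  have Q: "refines Q" using refines_rtranclp assms .
  then obtain e where e: "expansion Q e" by (auto simp: refines_def)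
  have "finite (dom Q)" "0 \<in> dom Q" using Q start by (auto simp: refines_def)
  then have "length (the (Q 0)) \<le> slp_size Q" unfolding slp_size_def by (intro member_le_sum) auto
  moreover have "length (e s) = 1 \<or> occurs_twice R (e s)" for s
    using e by (cases "s \<in> N ` (dom Q - dom P)") (auto simp: expansion_def)
  ultimately show thesis using e that[of "map e (the (Q 0))"] by (auto simp: expansion_def)
qed

end

text \<open>A piece of length at least two that occurs only once cannot lie inside a factor that
  occurs twice, so it has to be cut by the coarser factorization \<open>zs\<close>.\<close>

lemma count_unique_pieces:
  assumes "concat zs = u @ concat ws"
    and "\<And>z w. z \<in> set zs \<Longrightarrow> U w \<Longrightarrow> \<not> sublist w z" "\<not> U []"
  shows "length (filter U ws) \<le> length zs"
  using assms(1,2)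
proof (induction "length zs + length ws" arbitrary: zs ws u rule: less_induct)
  case less
  show ?case
  proof (cases ws)
    case (Cons w ws')
    show ?thesis
    proof (cases "U w")
      case False
      have "concat zs = (u @ w) @ concat ws'" using less.prems Cons by simp
      then show ?thesis using less.hyps[of zs ws' "u @ w"] less.prems(2) False Cons by auto
    next
      case True
      then have "w \<noteq> []" using assms(3) by auto
      then obtain z zs' where zs: "zs = z # zs'" using less.prems Cons by (cases zs) auto
      have eq: "z @ concat zs' = u @ w @ concat ws'" using less.prems Cons zs by simp
      \<comment> \<open>If \<open>z\<close> reached the end of \<open>u @ w\<close>, it would
        contain \<open>w\<close>. So \<open>z\<close> ends inside \<open>u @ w\<close> and can be
        charged to \<open>w\<close>; the rest of \<open>u @ w\<close> becomes the new offset
        \<open>u'\<close>.\<close>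
      have "length z < length (u @ w)"
      proof (rule ccontr)
        assume "\<not> length z < length (u @ w)"
        then have "length (u @ w) \<le> length z" by simp
        moreover have "prefix (u @ w) (z @ concat zs')" unfolding eq by (simp add: prefix_def)
        ultimately have "prefix (u @ w) z"
          using prefix_length_prefix[of _ "z @ concat zs'" z] by (meson prefix_order.order_refl prefixI)
        then obtain b where "z = (u @ w) @ b" by (auto elim: prefixE)
        then have "sublist w z" by (auto simp: sublist_def)
        then show False using less.prems(2) True zs by auto
      qed
      then have "length z \<le> length (u @ w)" by simp
      moreover have "prefix (u @ w) (z @ concat zs')" unfolding eq by (simp add: prefix_def)
      ultimately have "prefix z (u @ w)"
        using prefix_length_prefix[of z "z @ concat zs'"] by (meson prefixI)
      then obtain u' where "u @ w = z @ u'" by (auto elim: prefixE)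
      then have "z @ concat zs' = z @ u' @ concat ws'" unfolding eq by (metis append.assoc)
      then have "concat zs' = u' @ concat ws'" by simp
      then show ?thesis using less.hyps[of zs' ws' u'] less.prems(2) Cons zs by auto
    qed
  qed simp
qed

lemma ex_chunks:
  assumes "L > 0"
  shows "\<exists>ws. concat ws = xs \<and> length (filter (\<lambda>w. length w = L) ws) \<ge> length xs div L"
proof (induction "length xs" arbitrary: xs rule: less_induct)
  case less
  show ?case
  proof (cases "length xs < L")
    case True
    then show ?thesis by (intro exI[of _ "[xs]"]) auto
  next
    case False
    then have "length (drop L xs) < length xs" using assms by simp
    then obtain ws where ws: "concat ws = drop L xs"
      "length (filter (\<lambda>w. length w = L) ws) \<ge> length (drop L xs) div L"
      using less by blast
    have "length xs div L = Suc (length (drop L xs) div L)"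
      using False assms by (simp add: le_div_geq)
    then show ?thesis using ws False by (intro exI[of _ "take L xs # ws"]) auto
  qed
qed

section \<open>The forced rounds\<close>

text \<open>RePair may give the fresh nonterminal of round \<open>i\<close> any name;
  \<open>f i\<close> records the choice. Index \<open>i\<close> stands for a letter deriving
  \<open>2 ^ i\<close> copies of \<open>T 1\<close>.\<close>

definition letter :: "(nat \<Rightarrow> nat) \<Rightarrow> nat \<Rightarrow> sym" where
  "letter f i = (case i of 0 \<Rightarrow> T 1 | Suc j \<Rightarrow> N (f j))"

text \<open>The indices decrease because each round leaves its unpaired letter to the left of those
  left by earlier rounds.\<close>

definition low_part :: "(nat \<Rightarrow> sym) \<Rightarrow> nat \<Rightarrow> nat \<Rightarrow> sym list" where
  "low_part X j v = map X (filter (bit v) (rev [0..<j]))"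

text \<open>The form that the block with exponent \<open>v\<close> takes after \<open>j\<close>
  rounds: a run still to be paired, the letters left over so far, and the end marker.\<close>

definition block :: "(nat \<Rightarrow> sym) \<Rightarrow> nat \<Rightarrow> nat \<Rightarrow> sym list" where
  "block X j v = replicate (v div 2 ^ j) (X j) @ low_part X j v @ [T 2]"

definition blocks :: "(nat \<Rightarrow> sym) \<Rightarrow> nat \<Rightarrow> nat list \<Rightarrow> sym list" where
  "blocks X j vs = concat (map (block X j) vs)"

lemma low_part_Suc: "low_part X (Suc j) v = (if bit v j then [X j] else []) @ low_part X j v"
  by (simp add: low_part_def)

lemma set_low_part: "set (low_part X j v) \<subseteq> X ` {..<j}"
  by (auto simp: low_part_def)

section \<open>The effect of one pairing round on the blocks\<close>

lemma repl_append_notin: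
  "x \<notin> set xs \<Longrightarrow> repl [x, x] Y (xs @ zs) = xs @ repl [x, x] Y zs"
  by (induction xs) auto

lemma repl_pair_replicate:
  assumes "zs = [] \<or> hd zs \<noteq> x"
  shows "repl [x, x] Y (replicate k x @ zs)
    = replicate (k div 2) Y @ (if odd k then [x] else []) @ repl [x, x] Y zs"
proof (induction k rule: nat_induct2)
  case 1
  then show ?case using assms by (cases zs) auto
qed auto

text \<open>Pairing halves the run of \<open>v div 2 ^ j\<close> letters and leaves one
  \<open>X j\<close> behind if the run is odd, which is the case precisely when bit \<open>j\<close>
  of \<open>v\<close> is set.\<close>

lemma repl_block:
  assumes "X j \<notin> X ` {..<j}" "X j \<noteq> T 2"
  shows "repl [X j, X j] (X (Suc j)) (block X j v @ zs)
    = block X (Suc j) v @ repl [X j, X j] (X (Suc j)) zs"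
proof -
  let ?r = "repl [X j, X j] (X (Suc j))"
  have notin: "X j \<notin> set (low_part X j v @ [T 2])" using set_low_part assms by fastforce
  have "?r (block X j v @ zs) = replicate (v div 2 ^ j div 2) (X (Suc j))
      @ (if odd (v div 2 ^ j) then [X j] else []) @ ?r ((low_part X j v @ [T 2]) @ zs)"
    unfolding block_def using notin
    by (subst append_assoc, subst repl_pair_replicate) (cases "low_part X j v", auto)
  also have "?r ((low_part X j v @ [T 2]) @ zs) = (low_part X j v @ [T 2]) @ ?r zs"
    by (rule repl_append_notin[OF notin])
  also have "v div 2 ^ j div 2 = v div 2 ^ Suc j" by (simp only: power_Suc2 div_mult2_eq)
  also have "odd (v div 2 ^ j) = bit v j" by (simp add: bit_iff_odd)
  finally show ?thesis by (simp add: block_def low_part_Suc)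
qed

lemma repl_blocks:
  assumes "X j \<notin> X ` {..<j}" "X j \<noteq> T 2"
  shows "repl [X j, X j] (X (Suc j)) (blocks X j vs) = blocks X (Suc j) vs"
proof (induction vs)
  case (Cons v vs)
  then show ?case using repl_block[where X=X and j=j, OF assms, of v "blocks X j vs"]
    by (simp add: blocks_def)
qed (simp add: blocks_def)

lemma blocks_cong: "(\<And>i. i \<le> j \<Longrightarrow> X i = Y i) \<Longrightarrow> blocks X j vs = blocks Y j vs"
proof -
  assume eq: "\<And>i. i \<le> j \<Longrightarrow> X i = Y i"
  have "low_part X j v = low_part Y j v" for v
    unfolding low_part_def by (intro map_cong) (auto intro: eq)
  then have "block X j = block Y j" by (simp add: fun_eq_iff block_def eq)
  then show ?thesis by (simp add: blocks_def)
qed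

lemma filter_eq_blocks:
  assumes "X j \<notin> X ` {..<j}" "X j \<noteq> T 2"
  shows "length (filter (\<lambda>y. y = X j) (blocks X j vs)) = (\<Sum>v\<leftarrow>vs. v div 2 ^ j)"
proof -
  have "X j \<notin> set (low_part X j v)" for v using set_low_part assms(1) by blast
  then have "filter (\<lambda>y. y = X j) (low_part X j v) = []" for v by (auto simp: filter_empty_conv)
  then have "length (filter (\<lambda>y. y = X j) (block X j v)) = v div 2 ^ j" for v
    using assms(2) by (simp add: block_def)
  then show ?thesis by (induction vs) (simp_all add: blocks_def)
qed

lemma filter_neq_blocks:
  "length (filter (\<lambda>y. y \<noteq> X j) (blocks X j vs)) \<le> length vs * (j + 1)"
proof -
  have "length (filter (\<lambda>y. y \<noteq> X j) (low_part X j v)) \<le> j" for v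
    unfolding low_part_def
    by (metis diff_zero le_trans length_filter_le length_map length_rev length_upt)
  then have block_le: "length (filter (\<lambda>y. y \<noteq> X j) (block X j v)) \<le> j + 1" for v
    unfolding block_def filter_append length_append by (simp add: add_mono le_SucI)
  show ?thesis
  proof (induction vs)
    case (Cons v vs)
    then show ?case using block_le[of v] by (simp add: blocks_def)
  qed (simp add: blocks_def)
qed

text \<open>The grammar after \<open>j\<close> forced rounds, determined up to the names
  \<open>f\<close> of the nonterminals.\<close>

definition stage :: "nat list \<Rightarrow> nat \<Rightarrow> (nat \<Rightarrow> nat) \<Rightarrow> grammar \<Rightarrow> bool" where
  "stage vs j f P \<longleftrightarrow> inj_on f {..<j} \<and> 0 \<notin> f ` {..<j} \<and> dom P = insert 0 (f ` {..<j})
     \<and> P 0 = Some (blocks (letter f) j vs)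
     \<and> (\<forall>i<j. P (f i) = Some [letter f i, letter f i])"

lemma letter_neq_T2: "letter f i \<noteq> T 2"
  by (simp add: letter_def split: nat.split)

lemma inj_letter:
  assumes "inj_on f {..<j}"
  shows "inj_on (letter f) {..j}"
proof (rule inj_onI)
  fix a b assume "a \<in> {..j}" "b \<in> {..j}" "letter f a = letter f b"
  then show "a = b"
    using assms by (cases a; cases b) (auto simp: letter_def dest: inj_onD)
qed

lemma letter_notin: "inj_on f {..<j} \<Longrightarrow> letter f j \<notin> letter f ` {..<j}"
  using inj_letter[of f j] by (auto dest: inj_onD)

lemma occ_stage:
  assumes "stage vs j f P"
  shows "occ P d = cnt d (blocks (letter f) j vs) + (\<Sum>i<j. cnt d [letter f i, letter f i])"
proof -
  have s: "inj_on f {..<j}" "0 \<notin> f ` {..<j}" "dom P = insert 0 (f ` {..<j})"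
    "P 0 = Some (blocks (letter f) j vs)" "\<And>i. i < j \<Longrightarrow> P (f i) = Some [letter f i, letter f i]"
    using assms by (auto simp: stage_def)
  have "occ P d = cnt d (the (P 0)) + (\<Sum>A\<in>f ` {..<j}. cnt d (the (P A)))"
    unfolding occ_def s(3) using s(2) by simp
  also have "(\<Sum>A\<in>f ` {..<j}. cnt d (the (P A))) = (\<Sum>i<j. cnt d (the (P (f i))))"
    using s(1) by (simp add: sum.reindex)
  also have "\<dots> = (\<Sum>i<j. cnt d [letter f i, letter f i])"
    using s(5) by (intro sum.cong) (auto simp del: cnt.simps)
  finally show ?thesis using s(4) by simp
qed

text \<open>A word containing some other letter cannot occur more often than the few other letters do,
  and a power \<open>x\<^sup>k\<close> with \<open>k \<ge> 3\<close> occurs only about \<open>2/k\<close> times as often as \<open>xx\<close>.\<close>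

lemma occ_less_pair:
  assumes st: "stage vs j f P" and d: "length d \<ge> 2" "d \<noteq> [letter f j, letter f j]"
    and large: "(\<Sum>v\<leftarrow>vs. v div 2 ^ j) > 3 * (length vs * (j + 1)) + 4 * j + 3"
  shows "occ P d < occ P [letter f j, letter f j]"
proof -
  let ?x = "letter f j" and ?R = "blocks (letter f) j vs"
  let ?C = "\<Sum>v\<leftarrow>vs. v div 2 ^ j" and ?E = "length vs * (j + 1)"
  have inj: "inj_on f {..<j}" using st by (simp add: stage_def)
  note notin = letter_notin[OF inj]
  have C: "length (filter (\<lambda>y. y = ?x) ?R) = ?C"
    by (rule filter_eq_blocks) (rule notin letter_neq_T2)+
  have E: "length (filter (\<lambda>y. y \<noteq> ?x) ?R) \<le> ?E"
    by (rule filter_neq_blocks)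
  have "?C \<le> 2 * cnt [?x, ?x] ?R + ?E + 1"
    using filter_le_cnt_pair[of ?x ?R] C E by linarith
  moreover have "cnt [?x, ?x] ?R \<le> occ P [?x, ?x]" unfolding occ_stage[OF st] by simp
  ultimately have lower: "?C \<le> 2 * occ P [?x, ?x] + ?E + 1" by linarith
  \<comment> \<open>The pair occurs at least \<open>(?C - ?E - 1) / 2\<close> times. A word with
    another letter occurs at most \<open>?E + 2 * j\<close> times, a longer power at most
    \<open>?C / 3\<close> times. The bound \<open>large\<close> on \<open>?C\<close> makes both
    smaller.\<close>
  show ?thesis
  proof (cases "\<exists>y\<in>set d. y \<noteq> ?x")
    case True
    then have "filter (\<lambda>y. y \<noteq> ?x) d \<noteq> []" by (auto simp: filter_empty_conv)
    then have "length (filter (\<lambda>y. y \<noteq> ?x) d) \<ge> 1" by (simp add: Suc_le_eq)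
    then have le: "cnt d xs \<le> length (filter (\<lambda>y. y \<noteq> ?x) xs)" for xs
      using cnt_mult_filter_le[of d xs "\<lambda>y. y \<noteq> ?x"] by (metis le_trans mult.right_neutral mult_le_mono2)
    have "cnt d ?R \<le> ?E" using le[of ?R] E by linarith
    moreover have "(\<Sum>i<j. cnt d [letter f i, letter f i]) \<le> (\<Sum>i<j. 2)"
    proof (rule sum_mono)
      fix i
      show "cnt d [letter f i, letter f i] \<le> 2"
        using cnt_le_length[of d "[letter f i, letter f i]"] d(1) by (simp del: cnt.simps)
    qed
    ultimately have "occ P d \<le> ?E + 2 * j" unfolding occ_stage[OF st] by simp
    then show ?thesis using lower large by linarith
  next
    case False
    then have all: "filter (\<lambda>y. y = ?x) d = d" by (auto simp: filter_id_conv)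
    from False have "d = replicate (length d) ?x" using replicate_length_same[of d ?x] by simp
    have "length d \<noteq> 2"
    proof
      assume "length d = 2"
      with \<open>d = _\<close> have "d = replicate 2 ?x" by simp
      then show False using d(2) by (simp add: numeral_2_eq_2)
    qed
    then have d3: "length d \<ge> 3" using d(1) by linarith
    have le: "cnt d xs * 3 \<le> length (filter (\<lambda>y. y = ?x) xs)" for xs
      using cnt_mult_filter_le[of d xs "\<lambda>y. y = ?x"] mult_le_mono2[OF d3, of "cnt d xs"]
      unfolding all by linarith
    have "(\<Sum>i<j. cnt d [letter f i, letter f i]) = 0"
    proof (rule sum.neutral, rule ballI)
      fix i assume "i \<in> {..<j}"
      then have "letter f i \<noteq> ?x" using notin by (metis image_eqI)
      then show "cnt d [letter f i, letter f i] = 0" using le[of "[letter f i, letter f i]"]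
          by (simp del: cnt.simps)
    qed
    then have "3 * occ P d \<le> ?C" using le[of ?R] C unfolding occ_stage[OF st] by simp
    then show ?thesis using lower large by linarith
  qed
qed

lemma pair_maximal:
  assumes st: "stage vs j f P"
    and large: "(\<Sum>v\<leftarrow>vs. v div 2 ^ j) > 3 * (length vs * (j + 1)) + 4 * j + 3"
  shows "maximal_string P [letter f j, letter f j]"
proof -
  let ?x = "letter f j" and ?R = "blocks (letter f) j vs"
  have inj: "inj_on f {..<j}" using st by (simp add: stage_def)
  have "length (filter (\<lambda>y. y = ?x) ?R) = (\<Sum>v\<leftarrow>vs. v div 2 ^ j)"
    by (rule filter_eq_blocks) (rule letter_notin[OF inj] letter_neq_T2)+
  then have "2 * cnt [?x, ?x] ?R \<ge> 3"
    using filter_le_cnt_pair[of ?x ?R] filter_neq_blocks[of "letter f" j vs] large by linarith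
  then have "occ P [?x, ?x] \<ge> 2" unfolding occ_stage[OF st] by linarith
  moreover have "occ P d < occ P [?x, ?x]" if "length d > 2" for d
    by (rule occ_less_pair[OF st _ _ large]) (use that in auto)
  ultimately show ?thesis unfolding maximal_string_def by (auto simp: not_le)
qed

text \<open>The pair is itself maximal and beats every other candidate strictly, so the selected
  word must be the pair. Only the fresh name is free, and it becomes the value of \<open>f'\<close>
  at \<open>j\<close>.\<close>

lemma stage_step:
  assumes st: "stage vs j f P" and step: "repair_step P P'"
    and large: "(\<Sum>v\<leftarrow>vs. v div 2 ^ j) > 3 * (length vs * (j + 1)) + 4 * j + 3"
  shows "\<exists>f'. stage vs (Suc j) f' P'"
proof -
  let ?x = "letter f j" and ?R = "blocks (letter f) j vs"
  from step obtain gm X where gm: "length gm \<ge> 2" "\<And>d. maximal_string P d \<Longrightarrow> occ P d \<le> occ P gm"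
    and X: "X \<notin> dom P" and P': "P' = (\<lambda>A. map_option (repl gm (N X)) (P A))(X \<mapsto> gm)"
    by (elim repair_stepE) blast
  have gm_eq: "gm = [?x, ?x]"
    using occ_less_pair[OF st gm(1) _ large] gm(2)[OF pair_maximal[OF st large]] by fastforce
  have s: "inj_on f {..<j}" "0 \<notin> f ` {..<j}" "dom P = insert 0 (f ` {..<j})"
    "P 0 = Some (blocks (letter f) j vs)" "\<And>i. i < j \<Longrightarrow> P (f i) = Some [letter f i, letter f i]"
    using st by (auto simp: stage_def)
  define f' where "f' = f(j := X)"
  have f'_lt: "f' i = f i" if "i < j" for i using that by (simp add: f'_def)
  have letter_le: "letter f' i = letter f i" if "i \<le> j" for i
    using that f'_lt by (auto simp: letter_def split: nat.split)
  have im: "f' ` {..<Suc j} = insert X (f ` {..<j})"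
    using f'_lt by (auto simp: lessThan_Suc f'_def)
  have "inj_on f' {..<j}" using s(1) f'_lt by (simp add: inj_on_def)
  moreover have "f' j \<notin> f' ` {..<j}" using X s(3) f'_lt by (auto simp: f'_def)
  ultimately have inj': "inj_on f' {..<Suc j}" by (simp add: lessThan_Suc)
  have "letter f' (Suc j) = N X" by (simp add: letter_def f'_def)
  then have "repl gm (N X) ?R = repl [letter f' j, letter f' j] (letter f' (Suc j)) (blocks (letter f') j vs)"
    using letter_le gm_eq blocks_cong[of j "letter f" "letter f'" vs] by simp
  also have "\<dots> = blocks (letter f') (Suc j) vs"
    by (rule repl_blocks) (rule letter_notin[OF \<open>inj_on f' {..<j}\<close>] letter_neq_T2)+
  finally have R: "repl gm (N X) ?R = blocks (letter f') (Suc j) vs" .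
  have rule: "P' (f' i) = Some [letter f' i, letter f' i]" if "i < Suc j" for i
  proof (cases "i = j")
    case True
    then show ?thesis using gm_eq letter_le by (simp add: P' f'_def)
  next
    case False
    then have "i < j" using that by simp
    then have "letter f i \<noteq> ?x" using letter_notin[OF s(1)] by (metis image_eqI lessThan_iff)
    moreover have "f i \<noteq> X" using \<open>i < j\<close> X s(3) by auto
    ultimately show ?thesis using \<open>i < j\<close> s(5) f'_lt letter_le gm_eq by (simp add: P')
  qed
  have "0 \<noteq> X" using X s(3) by auto
  then have "P' 0 = Some (blocks (letter f') (Suc j) vs)" using s(4) R by (simp add: P')
  moreover have "dom P' = insert 0 (f' ` {..<Suc j})"
    unfolding im P' dom_repl_upd s(3) by auto
  moreover have "0 \<notin> f' ` {..<Suc j}" unfolding im using \<open>0 \<noteq> X\<close> s(2) by auto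
  ultimately show ?thesis unfolding stage_def using inj' rule by blast
qed

text \<open>A finished run cannot stop at a stage in which the pair is still maximal, so every
  finished run passes through stage \<open>j\<close>.\<close>

lemma forced_rounds:
  assumes "stage vs 0 f P0" "repair_step\<^sup>*\<^sup>* P0 P" "\<not> (\<exists>gm. maximal_string P gm)"
    and "\<And>i. i < j \<Longrightarrow> (\<Sum>v\<leftarrow>vs. v div 2 ^ i) > 3 * (length vs * (i + 1)) + 4 * i + 3"
  shows "\<exists>f Q. stage vs j f Q \<and> repair_step\<^sup>*\<^sup>* Q P"
  using assms(4)
proof (induction j)
  case 0
  then show ?case using assms(1,2) by (intro exI conjI)
next
  case (Suc j)
  then obtain f Q where Q: "stage vs j f Q" "repair_step\<^sup>*\<^sup>* Q P" by auto
  have large: "(\<Sum>v\<leftarrow>vs. v div 2 ^ j) > 3 * (length vs * (j + 1)) + 4 * j + 3" using Suc.prems by simp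
  have "Q \<noteq> P" using pair_maximal[OF Q(1) large] assms(3) by blast
  then obtain Q' where "repair_step Q Q'" "repair_step\<^sup>*\<^sup>* Q' P"
    using Q(2) by (auto elim: converse_rtranclpE)
  then obtain f' where "stage vs (Suc j) f' Q'" using stage_step[OF Q(1) _ large] by blast
  then show ?case using \<open>repair_step\<^sup>*\<^sup>* Q' P\<close> by (intro exI conjI)
qed

lemma stage_0:
  "stage vs 0 f [0 \<mapsto> map T (concat (map (\<lambda>v. replicate v 1 @ [2]) vs))]"
proof -
  have "map T (concat (map (\<lambda>v. replicate v 1 @ [2]) vs)) = blocks (letter f) 0 vs"
    by (induction vs) (simp_all add: blocks_def block_def low_part_def, simp_all add: letter_def)
  then show ?thesis by (simp add: stage_def)
qed

section \<open>Low windows are unique\<close>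

text \<open>Without the end marker \<open>b\<close>, the word \<open>w\<close> cannot cross a block
  boundary; without letters of the heads \<open>h\<close>, it cannot reach into a head. Only one
  part \<open>l\<close> is left for it.\<close>

lemma factor_within_block:
  assumes "concat (map (\<lambda>p. h p @ l p @ [b]) ps) = pre @ w @ suf" "w \<noteq> []"
    and "b \<notin> set w" "\<And>p. p \<in> set ps \<Longrightarrow> set (h p) \<inter> set w = {}"
  shows "\<exists>k<length ps. \<exists>a c. l (ps ! k) = a @ w @ c
    \<and> pre = concat (map (\<lambda>p. h p @ l p @ [b]) (take k ps)) @ h (ps ! k) @ a"
  using assms(1,4)
proof (induction ps arbitrary: pre)
  case Nil
  then show ?case using assms(2) by simp
next
  case (Cons p ps)
  let ?B = "\<lambda>p. h p @ l p @ [b]"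
  have eq: "?B p @ concat (map ?B ps) = pre @ w @ suf" using Cons.prems by simp
  from append_eq_append_conv2[THEN iffD1, OF eq]
  obtain v where "?B p = pre @ v \<and> v @ concat (map ?B ps) = w @ suf
      \<or> ?B p @ v = pre \<and> concat (map ?B ps) = v @ w @ suf" by blast
  then show ?case
  proof (elim disjE conjE)
    assume pre: "?B p @ v = pre" and "concat (map ?B ps) = v @ w @ suf"
    then obtain k a c where "k < length ps" "l (ps ! k) = a @ w @ c"
      "v = concat (map ?B (take k ps)) @ h (ps ! k) @ a"
      using Cons.IH[of v] Cons.prems by auto
    then show ?thesis using pre by (intro exI[of _ "Suc k"]) auto
  next
    assume pre: "?B p = pre @ v" and v: "v @ concat (map ?B ps) = w @ suf"
    show ?thesis
    proof (cases v rule: rev_exhaust)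
      case Nil
      then obtain k a c where "k < length ps" "l (ps ! k) = a @ w @ c"
        "[] = concat (map ?B (take k ps)) @ h (ps ! k) @ a"
        using Cons.IH[of "[]"] Cons.prems v by auto
      then show ?thesis using pre Nil by (intro exI[of _ "Suc k"]) auto
    next
      case (snoc v' x)
      then have "x = b" and hl: "h p @ l p = pre @ v'" using pre by auto
      then have "v' @ b # concat (map ?B ps) = w @ suf" using v snoc by simp
      then obtain c where v': "v' = w @ c"
        using assms(3) by (auto simp: append_eq_append_conv2 Cons_eq_append_conv append_eq_Cons_conv)
      with hl have "h p @ l p = pre @ w @ c" by simp
      then obtain a where "pre = h p @ a"
        using assms(2) Cons.prems(2)[of p]
        by (cases w) (auto simp: append_eq_append_conv2 append_eq_Cons_conv Cons_eq_append_conv)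
      then show ?thesis using hl v' by (intro exI[of _ 0]) auto
    qed
  qed
qed

lemma distinct_append_unique:
  assumes "distinct xs" "xs = a @ w @ c" "xs = a' @ w @ c'" "w \<noteq> []"
  shows "a = a'"
proof -
  obtain z w' where "w = z # w'" using assms(4) by (cases w) auto
  then show ?thesis using assms(1-3)
    by (metis append_Cons append_Cons_eq_iff distinct_append not_distinct_conv_prefix
      disjoint_insert(1) list.simps(15) distinct.simps(2))
qed

text \<open>Each step drops by at least one. Hence a window of \<open>len + 1\<close> letters of a
  low part stretches over at least \<open>len\<close> binary digits.\<close>

lemma decreasing_last_le:
  "sorted_wrt (>) (q # qs) \<Longrightarrow> last (q # qs) + length qs \<le> (q :: nat)"
proof (induction qs arbitrary: q)
  case (Cons r qs)
  then have "last (r # qs) + length qs \<le> r" "r < q" by auto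
  then show ?case by simp
qed simp

text \<open>Elements before \<open>qs\<close> are larger than its head, elements after it smaller
  than its last entry. So a window listing one-bits also reveals the zero-bits between them.\<close>

lemma mem_contiguous_iff:
  assumes "sorted_wrt (>) (a @ qs @ c)" "qs \<noteq> []" "last qs \<le> q" "q \<le> (hd qs :: nat)"
  shows "q \<in> set (a @ qs @ c) \<longleftrightarrow> q \<in> set qs"
proof -
  have "\<forall>x\<in>set a. hd qs < x" "\<forall>x\<in>set c. x < last qs"
    using assms(1,2) by (simp_all add: sorted_wrt_append)
  then have "q \<notin> set a" "q \<notin> set c" using assms(3,4) by (meson leD)+
  then show ?thesis by simp
qed

lemma map_eq_inj_on:
  assumes "inj_on X A" "map X xs = map X ys" "set xs \<subseteq> A" "set ys \<subseteq> A"
  shows "xs = ys"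
  using assms by (metis inj_on_map_eq_map inj_on_subset le_sup_iff)

section \<open>Exponents read off a bit sequence\<close>

fun prefix_value :: "(nat \<Rightarrow> bool) \<Rightarrow> nat \<Rightarrow> nat" where
  "prefix_value \<beta> 0 = 1"
| "prefix_value \<beta> (Suc p) = 2 * prefix_value \<beta> p + of_bool (\<beta> p)"

lemma bit_prefix_value: "q < p \<Longrightarrow> bit (prefix_value \<beta> p) q \<longleftrightarrow> \<beta> (p - 1 - q)"
proof (induction p arbitrary: q)
  case (Suc p)
  show ?case
  proof (cases q)
    case 0
    then show ?thesis by (simp add: bit_0)
  next
    case (Suc q')
    then show ?thesis using Suc.IH[of q'] Suc.prems by (simp add: bit_Suc)
  qed
qed simp

lemma prefix_value_bounds: "2 ^ p \<le> prefix_value \<beta> p" "prefix_value \<beta> p < 2 ^ Suc p"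
  by (induction p) auto

text \<open>All prefixes are longer than \<open>J\<close>, so the \<open>J\<close> low digits of
  every exponent are values of \<open>\<beta>\<close>, at positions below
  \<open>2 * J\<close>.\<close>

definition exponents :: "(nat \<Rightarrow> bool) \<Rightarrow> nat \<Rightarrow> nat list" where
  "exponents \<beta> J = map (prefix_value \<beta>) [J + 1..<2 * J + 1]"

lemma low_factor_in_block:
  assumes inj: "inj_on X {..J}" and T2: "\<And>i. X i \<noteq> T 2"
    and R: "blocks X J vs = pre @ w @ suf" and w: "w \<noteq> []" "set w \<subseteq> X ` {..<J}"
  obtains k a c where "k < length vs" "low_part X J (vs ! k) = a @ w @ c"
    "pre = blocks X J (take k vs) @ replicate ((vs ! k) div 2 ^ J) (X J) @ a"
proof -
  have "X J \<notin> X ` {..<J}" using inj by (auto dest: inj_onD)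
  then have "X J \<notin> set w" using w(2) by blast
  moreover have "T 2 \<notin> set w" using w(2) T2 by (metis imageE subsetD)
  ultimately show thesis
    using factor_within_block[of "\<lambda>v. replicate (v div 2 ^ J) (X J)" "low_part X J" "T 2" vs pre w suf]
      R w(1) that unfolding blocks_def block_def[abs_def] by fastforce
qed

text \<open>Equal windows in two blocks reveal equal windows of \<open>\<beta>\<close>, shifted by the difference of the
  prefix lengths, because a block lists the one-bits of its exponent.\<close>

lemma low_window_once:
  assumes inj: "inj_on X {..J}" and T2: "\<And>i. X i \<noteq> T 2"
    and \<beta>: "\<And>x y. x < 2 * J \<Longrightarrow> y < 2 * J \<Longrightarrow> (\<forall>t<len. \<beta> (x + t) = \<beta> (y + t)) \<Longrightarrow> x = y"
    and w: "length w = len + 1" "set w \<subseteq> X ` {..<J}"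
  shows "\<not> occurs_twice (blocks X J (exponents \<beta> J)) w"
proof
  let ?vs = "exponents \<beta> J" and ?u = "prefix_value \<beta>"
  let ?ones = "\<lambda>v. filter (bit v) (rev [0..<J])"
  have "w \<noteq> []" using w(1) by auto
  assume "occurs_twice (blocks X J ?vs) w"
  then obtain p s p' s' where R: "blocks X J ?vs = p @ w @ s" "blocks X J ?vs = p' @ w @ s'"
    and neq: "length p \<noteq> length p'" unfolding occurs_twice_def by blast
  obtain k a c where k: "k < length ?vs" "low_part X J (?vs ! k) = a @ w @ c"
    "p = blocks X J (take k ?vs) @ replicate ((?vs ! k) div 2 ^ J) (X J) @ a"
    by (rule low_factor_in_block[OF inj T2 R(1) \<open>w \<noteq> []\<close> w(2)])
  obtain k' a' c' where k': "k' < length ?vs" "low_part X J (?vs ! k') = a' @ w @ c'"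
    "p' = blocks X J (take k' ?vs) @ replicate ((?vs ! k') div 2 ^ J) (X J) @ a'"
    by (rule low_factor_in_block[OF inj T2 R(2) \<open>w \<noteq> []\<close> w(2)])
  have kJ: "k < J" "k' < J" using k(1) k'(1) by (simp_all add: exponents_def del: upt_Suc)
  have nth: "?vs ! i = ?u (J + 1 + i)" if "i < J" for i
    using that by (simp add: exponents_def del: upt_Suc)
  obtain A qs C where ones: "?ones (?vs ! k) = A @ qs @ C" and w_qs: "w = map X qs"
    using k(2) unfolding low_part_def by (metis map_eq_append_conv)
  obtain A' qs' C' where ones': "?ones (?vs ! k') = A' @ qs' @ C'" and w_qs': "w = map X qs'"
    using k'(2) unfolding low_part_def by (metis map_eq_append_conv)
  have ltJ: "set qs \<subseteq> {..<J}" "set qs' \<subseteq> {..<J}"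
    using ones[THEN arg_cong[where f = set]] ones'[THEN arg_cong[where f = set]] by auto
  have "inj_on X {..<J}" using inj by (rule inj_on_subset) auto
  then have qs': "qs' = qs" using w_qs w_qs' map_eq_inj_on ltJ by metis
  have sorted: "sorted_wrt (>) (?ones v)" for v
    by (intro sorted_wrt_filter) (simp add: sorted_wrt_rev)
  have qs: "qs \<noteq> []" "length qs = len + 1" using w(1) w_qs by auto
  have "sorted_wrt (>) qs" using sorted[of "?vs ! k"] unfolding ones by (simp add: sorted_wrt_append)
  then have last: "last qs + len \<le> hd qs"
    using decreasing_last_le[of "hd qs" "tl qs"] qs by simp
  have hd: "hd qs < J" using ltJ(1) hd_in_set[OF qs(1)] by blast
  have bit_eq: "bit (?vs ! k) q \<longleftrightarrow> bit (?vs ! k') q" if "last qs \<le> q" "q \<le> hd qs" for q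
  proof -
    have "q \<in> set (?ones (?vs ! k)) \<longleftrightarrow> q \<in> set qs"
      unfolding ones by (rule mem_contiguous_iff) (use sorted[of "?vs ! k"] ones qs that in auto)
    moreover have "q \<in> set (?ones (?vs ! k')) \<longleftrightarrow> q \<in> set qs"
      unfolding ones' qs' by (rule mem_contiguous_iff) (use sorted[of "?vs ! k'"] ones' qs' qs that in auto)
    ultimately show ?thesis using hd that by auto
  qed
  \<comment> \<open>Digit \<open>hd qs\<close> of the exponent with prefix length
    \<open>J + 1 + k\<close> is \<open>\<beta>\<close> at \<open>J + k - hd qs\<close>. Descending
    digits correspond to ascending positions of \<open>\<beta>\<close>, and \<open>len\<close> of
    them agree in both blocks.\<close>
  have "J + k - hd qs = J + k' - hd qs"
  proof (rule \<beta>)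
    show "\<forall>t<len. \<beta> (J + k - hd qs + t) = \<beta> (J + k' - hd qs + t)"
    proof (intro allI impI)
      fix t assume t: "t < len"
      let ?q = "hd qs - t"
      have "bit (?u (J + 1 + k)) ?q \<longleftrightarrow> bit (?u (J + 1 + k')) ?q"
        using bit_eq[of ?q] last t nth kJ by simp
      moreover have "J + 1 + k - 1 - ?q = J + k - hd qs + t" "J + 1 + k' - 1 - ?q = J + k' - hd qs + t"
        using hd last t by linarith+
      ultimately show "\<beta> (J + k - hd qs + t) = \<beta> (J + k' - hd qs + t)"
        using bit_prefix_value[of ?q "J + 1 + k" \<beta>] bit_prefix_value[of ?q "J + 1 + k'" \<beta>] hd by simp
    qed
  qed (use kJ hd in linarith)+
  then have "k = k'" using hd by linarith
  \<comment> \<open>Both occurrences now lie in the same low part, whose letters are pairwise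
    distinct, so their offsets in it coincide too.\<close>
  have "distinct (low_part X J (?vs ! k))"
    unfolding low_part_def distinct_map
    using \<open>inj_on X {..<J}\<close> by (auto intro: inj_on_subset)
  then have "a = a'" using distinct_append_unique k(2) k'(2) \<open>k = k'\<close> \<open>w \<noteq> []\<close> by metis
  then show False using neq k(3) k'(3) \<open>k = k'\<close> by simp
qed

section \<open>From unique windows to the size of the final grammar\<close>

lemma stage_inert_rules:
  assumes st: "stage vs J f P"
  shows "inert_rules P (blocks (letter f) J vs)"
proof -
  have s: "inj_on f {..<J}" "0 \<notin> f ` {..<J}" "dom P = insert 0 (f ` {..<J})"
    "P 0 = Some (blocks (letter f) J vs)" "\<And>i. i < J \<Longrightarrow> P (f i) = Some [letter f i, letter f i]"
    using st by (auto simp: stage_def)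
  have ruleD: "\<exists>i<J. A = f i \<and> the (P A) = [letter f i, letter f i]" if "A \<in> dom P - {0}" for A
    using that s(3,5) by auto
  have inj: "inj_on (letter f) {..J}" using inj_letter s(1) .
  have letter_dom: "B \<in> dom P" if "letter f i = N B" "i \<le> J" for i B
    using that s(3) by (auto simp: letter_def split: nat.splits)
  have blocks_letters: "set (blocks (letter f) J vs) \<subseteq> insert (T 2) (letter f ` {..J})"
    unfolding blocks_def block_def low_part_def by auto
  show ?thesis
  proof
    show "P 0 = Some (blocks (letter f) J vs)" by (rule s(4))
    show "finite (dom P)" by (simp add: s(3))
    show "closed_rules P"
      unfolding closed_rules_def
    proof (intro ballI allI impI)
      fix A B assume A: "A \<in> dom P" and B: "N B \<in> set (the (P A))"
      have "\<exists>i\<le>J. letter f i = N B"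
      proof (cases "A = 0")
        case True
        then show ?thesis using B s(4) blocks_letters by force
      next
        case False
        then show ?thesis using A B ruleD[of A] by (auto intro: less_imp_le)
      qed
      then show "B \<in> dom P" using letter_dom by blast
    qed
    show "length (the (P A)) = 2" if "A \<in> dom P - {0}" for A using ruleD[OF that] by auto
    show "inj_on (\<lambda>A. the (P A)) (dom P - {0})"
    proof (rule inj_onI)
      fix A B assume "A \<in> dom P - {0}" "B \<in> dom P - {0}" and eq: "the (P A) = the (P B)"
      then obtain i j where "i < J" "A = f i" "the (P A) = [letter f i, letter f i]"
        "j < J" "B = f j" "the (P B) = [letter f j, letter f j]" using ruleD by meson
      with eq inj show "A = B" by (auto dest: inj_onD)
    qed
    \<comment> \<open>A square of a letter with index below \<open>J\<close> would have to lie
      inside a single low part, which lists each letter at most once.\<close>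
    show "\<not> sublist (the (P A)) (blocks (letter f) J vs)" if A: "A \<in> dom P - {0}" for A
    proof
      assume "sublist (the (P A)) (blocks (letter f) J vs)"
      moreover obtain i where i: "i < J" "the (P A) = [letter f i, letter f i]" using ruleD[OF A] by blast
      ultimately obtain pre suf where R: "blocks (letter f) J vs = pre @ [letter f i, letter f i] @ suf"
        by (auto simp: sublist_def)
      obtain k a c where "low_part (letter f) J (vs ! k) = a @ [letter f i, letter f i] @ c"
        by (rule low_factor_in_block[OF inj letter_neq_T2 R]) (use i in auto)
      moreover have "inj_on (letter f) {..<J}" using inj by (rule inj_on_subset) auto
      then have "distinct (low_part (letter f) J (vs ! k))"
        unfolding low_part_def distinct_map by (auto intro: inj_on_subset)
      ultimately show False by simp
    qed
  qed
qed

text \<open>Each low part is cut into chunks of length \<open>L\<close>; the runs of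
  \<open>X J\<close> and the end markers become separate pieces that the bound does not rely
  on.\<close>

lemma blocks_pieces:
  assumes "L > 0"
  shows "\<exists>ws. concat ws = blocks X J vs
    \<and> (\<Sum>v\<leftarrow>vs. length (low_part X J v) div L)
      \<le> length (filter (\<lambda>w. length w = L \<and> set w \<subseteq> X ` {..<J}) ws)"
proof (induction vs)
  case Nil
  show ?case by (intro exI[of _ "[]"]) (simp add: blocks_def)
next
  case (Cons v vs)
  let ?U = "\<lambda>w. length w = L \<and> set w \<subseteq> X ` {..<J}"
  obtain ws where ws: "concat ws = blocks X J vs"
    "(\<Sum>v\<leftarrow>vs. length (low_part X J v) div L) \<le> length (filter ?U ws)" using Cons by blast
  obtain cs where cs: "concat cs = low_part X J v"
    "length (filter (\<lambda>w. length w = L) cs) \<ge> length (low_part X J v) div L"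
    using ex_chunks[OF assms] by blast
  have "set w \<subseteq> X ` {..<J}" if "w \<in> set cs" for w
    using that set_low_part[of X J v] unfolding cs(1)[symmetric] by auto
  then have "filter ?U cs = filter (\<lambda>w. length w = L) cs" by (intro filter_cong) auto
  then show ?case using ws cs
    by (intro exI[of _ "[replicate (v div 2 ^ J) (X J)] @ cs @ [[T 2]] @ ws"])
      (auto simp: blocks_def block_def)
qed

text \<open>A chunk of \<open>len + 1\<close> low letters occurs only once and has length at least
  two, so no symbol of the final start rule expands to a word containing it. The start rule
  therefore has at least as many symbols as there are chunks.\<close>

lemma repair_size_lower_bound:
  assumes st: "stage (exponents \<beta> J) J f P" and run: "repair_step\<^sup>*\<^sup>* P Q"
    and \<beta>: "\<And>x y. x < 2 * J \<Longrightarrow> y < 2 * J \<Longrightarrow> (\<forall>t<len. \<beta> (x + t) = \<beta> (y + t)) \<Longrightarrow> x = y"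
    and "len > 0"
  shows "(\<Sum>v\<leftarrow>exponents \<beta> J. length (low_part (letter f) J v) div (len + 1)) \<le> slp_size Q"
proof -
  let ?R = "blocks (letter f) J (exponents \<beta> J)"
  let ?U = "\<lambda>w. length w = len + 1 \<and> set w \<subseteq> letter f ` {..<J}"
  have inj: "inj_on (letter f) {..J}" using st inj_letter by (simp add: stage_def)
  obtain zs where zs: "length zs \<le> slp_size Q" "concat zs = ?R"
    "\<And>z. z \<in> set zs \<Longrightarrow> length z = 1 \<or> occurs_twice ?R z"
    by (rule inert_rules.repair_start_rule[OF stage_inert_rules[OF st] run]) blast
  obtain ws where ws: "concat ws = ?R"
    "(\<Sum>v\<leftarrow>exponents \<beta> J. length (low_part (letter f) J v) div (len + 1)) \<le> length (filter ?U ws)"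
    using blocks_pieces[of "len + 1" "letter f" J "exponents \<beta> J"] by auto
  have "length (filter ?U ws) \<le> length zs"
  proof (rule count_unique_pieces[of zs "[]" ws ?U])
    show "concat zs = [] @ concat ws" using zs ws by simp
    show "\<not> sublist w z" if z: "z \<in> set zs" and w: "?U w" for z w
    proof
      assume sub: "sublist w z"
      then have "length w \<le> length z" by (rule sublist_length_le)
      then have "length z \<noteq> 1" using w \<open>len > 0\<close> by simp
      then have "occurs_twice ?R w" using zs(3)[OF z] occurs_twice_sublist sub by blast
      moreover have "\<not> occurs_twice ?R w"
        by (rule low_window_once[OF inj letter_neq_T2 \<beta>]) (use w in auto)
      ultimately show False by contradiction
    qed
  qed simp
  then show ?thesis using ws(2) zs(1) by linarith
qed

section \<open>A dense bit pattern with unique short windows\<close>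

text \<open>Codeword number \<open>X\<close> is the marker \<open>00\<close> followed by \<open>1 b\<^sub>0 1 b\<^sub>1 \<dots> 1 b\<^sub>m\<close>, where the \<open>b\<^sub>i\<close> are the
  binary digits of \<open>X\<close>. The string \<open>001\<close> occurs only at the start of a codeword, so a window that
  contains a whole codeword reveals its own position.\<close>

definition pattern :: "nat \<Rightarrow> nat \<Rightarrow> bool" where
  "pattern m x \<longleftrightarrow> (let s = x mod (2 * m + 4) in
     2 \<le> s \<and> (even s \<or> bit (x div (2 * m + 4)) ((s - 3) div 2)))"

lemma pattern_at:
  assumes "s < 2 * m + 4"
  shows "pattern m ((2 * m + 4) * X + s) \<longleftrightarrow> 2 \<le> s \<and> (even s \<or> bit X ((s - 3) div 2))"
proof -
  have "((2 * m + 4) * X + s) mod (2 * m + 4) = s" "((2 * m + 4) * X + s) div (2 * m + 4) = X"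
    using assms by simp_all
  then show ?thesis by (simp only: pattern_def Let_def)
qed

text \<open>Even offsets from two on carry a one, so a nonzero offset of \<open>y\<close> is odd.
  Then \<open>y + 1\<close> carries a one, unless \<open>y\<close> is the last position of a
  codeword; in that case \<open>y + 2\<close> is the second zero of the next marker.\<close>

lemma pattern_marker:
  assumes "\<not> pattern m y" "\<not> pattern m (y + 1)" "pattern m (y + 2)"
  shows "y mod (2 * m + 4) = 0"
proof (rule ccontr)
  let ?c = "2 * m + 4"
  define Y s where "Y = y div ?c" and "s = y mod ?c"
  have y: "y = ?c * Y + s" and s: "s < ?c" unfolding Y_def s_def by simp_all
  assume "y mod ?c \<noteq> 0"
  then have "s \<noteq> 0" by (simp add: s_def)
  have "odd s"
  proof
    assume "even s"
    with \<open>s \<noteq> 0\<close> have "2 \<le> s" by presburger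
    with \<open>even s\<close> show False using assms(1) unfolding y pattern_at[OF s] by blast
  qed
  show False
  proof (cases "s + 1 < ?c")
    case True
    then show False
      using assms(2) \<open>odd s\<close> \<open>s \<noteq> 0\<close> pattern_at[OF True, of Y] unfolding y by (simp add: add.assoc)
  next
    case False
    then have "y + 2 = ?c * (Y + 1) + 1" using s y by simp
    then show False using assms(3) pattern_at[of 1 m "Y + 1"] by simp
  qed
qed

lemma pattern_window_unique:
  assumes "x < (2 * m + 4) * 2 ^ m" "y < (2 * m + 4) * 2 ^ m"
    and eq: "\<forall>t < 2 * (2 * m + 4). pattern m (x + t) = pattern m (y + t)"
  shows "x = y"
proof -
  define c where "c = 2 * m + 4"
  have "c \<ge> 4" by (simp add: c_def)
  \<comment> \<open>Rounding \<open>x / c\<close> up yields the first codeword that starts at or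
    after \<open>x\<close>. Its distance \<open>i\<close> is below \<open>c\<close>, so a window of
    length \<open>2 * c\<close> contains the whole codeword.\<close>
  define X r where "X = (x + c - 1) div c" and "r = (x + c - 1) mod c"
  have "c * X + r = x + c - 1" unfolding X_def r_def by simp
  moreover have "r < c" unfolding r_def using \<open>c \<ge> 4\<close> by simp
  ultimately obtain i where i: "x + i = c * X" "i < c"
    using \<open>c \<ge> 4\<close> that[of "c - 1 - r"] by linarith
  have at: "pattern m (c * Z + s) \<longleftrightarrow> 2 \<le> s \<and> (even s \<or> bit Z ((s - 3) div 2))" if "s < c" for Z s
    using pattern_at that unfolding c_def .
  have shift: "pattern m (c * X + s) = pattern m (y + i + s)" if "s < c" for s
  proof -
    have "c * X + s = x + (i + s)" using i(1) by simp
    moreover have "i + s < 2 * (2 * m + 4)" using that i(2) unfolding c_def by presburger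
    ultimately show ?thesis using eq by (simp add: add.assoc)
  qed
  have "(y + i) mod c = 0"
    unfolding c_def
  proof (rule pattern_marker)
    show "\<not> pattern m (y + i)" using shift[of 0] at[of 0 X] \<open>c \<ge> 4\<close> by simp
    show "\<not> pattern m (y + i + 1)" using shift[of 1] at[of 1 X] \<open>c \<ge> 4\<close> by simp
    show "pattern m (y + i + 2)" using shift[of 2] at[of 2 X] \<open>c \<ge> 4\<close> by simp
  qed
  then obtain Y where Y: "y + i = c * Y" by (metis dvdE mod_eq_0_iff_dvd)
  \<comment> \<open>Rounding up may produce the number \<open>2 ^ m\<close> itself, which is why
    codewords carry \<open>m + 1\<close> digits.\<close>
  have le: "Z < 2 ^ Suc m" if "z + i = c * Z" "z < c * 2 ^ m" for z Z
  proof -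
    have "c * Z < c * (2 ^ m + 1)" using that i(2) by simp
    then have "Z < 2 ^ m + 1" by (simp only: mult_less_cancel1)
    also have "\<dots> \<le> 2 ^ Suc m" by simp
    finally show ?thesis .
  qed
  have "take_bit (Suc m) X = take_bit (Suc m) Y"
  proof (rule bit_eqI)
    fix b
    show "bit (take_bit (Suc m) X) b = bit (take_bit (Suc m) Y) b"
    proof (cases "b < Suc m")
      case True
      then have b: "2 * b + 3 < c" by (simp add: c_def)
      show ?thesis using shift[OF b] at[OF b, of X] at[OF b, of Y] True unfolding Y by (simp add: bit_take_bit_iff)
    qed (simp add: bit_take_bit_iff)
  qed
  moreover have "X < 2 ^ Suc m" "Y < 2 ^ Suc m"
    using le[OF i(1)] le[OF Y] assms(1,2) by (simp_all add: c_def)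
  ultimately have "X = Y" by (simp add: take_bit_nat_eq_self del: power_Suc)
  then show ?thesis using i(1) Y by simp
qed

text \<open>Away from the marker every second bit is a one. The worst start is the last position of
  a codeword, where a zero digit may be followed by the two marker zeros.\<close>

lemma pattern_dense: "\<exists>t<4. pattern m (x + t)"
proof -
  let ?c = "2 * m + 4"
  define X s where "X = x div ?c" and "s = x mod ?c"
  have x: "x = ?c * X + s" and s: "s < ?c" unfolding X_def s_def by simp_all
  consider "s = 0" | "s \<noteq> 0" "even s" | "odd s" "s + 1 < ?c" | "odd s" "s + 1 = ?c"
    using s by linarith
  then show ?thesis
  proof cases
    case 1
    then have "pattern m (x + 2)" using pattern_at[of 2 m X] x by simp
    then show ?thesis by (intro exI[of _ 2]) simp
  next
    case 2
    then have "s \<ge> 2" by presburger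
    then have "pattern m (x + 0)" using pattern_at[OF s, of X] x 2 by simp
    then show ?thesis by (intro exI[of _ 0]) simp
  next
    case 3
    then have "2 \<le> s + 1 \<and> even (s + 1)" by presburger
    then have "pattern m (?c * X + (s + 1))" using pattern_at[OF 3(2), of X] by blast
    then have "pattern m (x + 1)" using x by (simp add: add.assoc)
    then show ?thesis by (intro exI[of _ 1]) simp
  next
    case 4
    then have "x + 3 = ?c * (X + 1) + 2" using x by simp
    then have "pattern m (x + 3)" using pattern_at[of 2 m "X + 1"] by simp
    then show ?thesis by (intro exI[of _ 3]) simp
  qed
qed

lemma length_filter_dense:
  assumes "\<And>q. q + 4 \<le> J \<Longrightarrow> \<exists>t<4. P (q + t)"
  shows "J div 4 \<le> length (filter P [0..<J])"
  using assms
proof (induction J rule: less_induct)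
  case (less J)
  show ?case
  proof (cases "J < 4")
    case False
    then obtain t where t: "t < 4" "P (J - 4 + t)" using less.prems[of "J - 4"] by auto
    have "[0..<J] = [0..<J - 4] @ [J - 4..<J]" using upt_add_eq_append[of 0 "J - 4" 4] False by simp
    moreover have "filter P [J - 4..<J] \<noteq> []"
    proof -
      have "J - 4 + t \<in> set [J - 4..<J]"
        unfolding set_upt atLeastLessThan_iff using t(1) False by linarith
      then show ?thesis using t(2) by (meson filter_empty_conv)
    qed
    then have "length (filter P [J - 4..<J]) \<ge> 1" by (simp add: Suc_le_eq)
    moreover have "(J - 4) div 4 \<le> length (filter P [0..<J - 4])"
    proof (rule less.IH)
      show "\<exists>t<4. P (q + t)" if "q + 4 \<le> J - 4" for q using less.prems[of q] that by simp
    qed (use False in simp)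
    moreover have "J div 4 = (J - 4) div 4 + 1" using False by (simp add: le_div_geq)
    ultimately show ?thesis by simp
  qed simp
qed

lemma length_low_part:
  assumes "J \<le> p" "\<And>x. \<exists>t<4. \<beta> (x + t)"
  shows "J div 4 \<le> length (low_part X J (prefix_value \<beta> p))"
proof -
  have "J div 4 \<le> length (filter (bit (prefix_value \<beta> p)) [0..<J])"
  proof (rule length_filter_dense)
    fix q assume q: "q + 4 \<le> J"
    obtain t where t: "t < 4" "\<beta> (p - 4 - q + t)" using assms(2) by blast
    \<comment> \<open>Digits of the exponent run against the order of \<open>\<beta>\<close>, so the
      window of four positions is mirrored and \<open>t\<close> turns into
      \<open>3 - t\<close>.\<close>
    have "q + (3 - t) < p" "p - 1 - (q + (3 - t)) = p - 4 - q + t" using q t(1) assms(1) by linarith+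
    then have "bit (prefix_value \<beta> p) (q + (3 - t))" using bit_prefix_value t(2) by metis
    then show "\<exists>t<4. bit (prefix_value \<beta> p) (q + t)" by (intro exI[of _ "3 - t"]) simp
  qed
  then show ?thesis by (simp add: low_part_def rev_filter[symmetric])
qed

section \<open>A small grammar by repeated doubling\<close>

definition word :: "(nat \<Rightarrow> bool) \<Rightarrow> nat \<Rightarrow> nat list" where
  "word \<beta> J = concat (map (\<lambda>v. replicate v 1 @ [2]) (exponents \<beta> J))"

text \<open>Horner's rule as a grammar: nonterminal \<open>p <= 2 * J\<close> produces the unary
  form of \<open>prefix_value \<beta> p\<close>, and \<open>2 * J + 1\<close> is the start symbol.
  Rules refer to smaller names only, which gives acyclicity.\<close>

definition doubling :: "(nat \<Rightarrow> bool) \<Rightarrow> nat \<Rightarrow> grammar" where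
  "doubling \<beta> J p = (if p = 0 then Some [T 1]
     else if p \<le> 2 * J then Some ([N (p - 1), N (p - 1)] @ (if \<beta> (p - 1) then [T 1] else []))
     else if p = 2 * J + 1 then Some (concat (map (\<lambda>p. [N p, T 2]) [J + 1..<2 * J + 1]))
     else None)"

lemma dom_doubling: "dom (doubling \<beta> J) = {..2 * J + 1}"
  by (auto simp: doubling_def dom_def split: if_splits)

lemma derives_doubling: "p \<le> 2 * J \<Longrightarrow> derives (doubling \<beta> J) (N p) (replicate (prefix_value \<beta> p) 1)"
proof (induction p)
  case 0
  have "derives_list (doubling \<beta> J) [T 1] ([1] @ [])"
    by (intro derives_derives_list.intros)
  moreover have "doubling \<beta> J 0 = Some [T 1]" by (simp add: doubling_def)
  ultimately show ?case using der_N by fastforce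
next
  case (Suc p)
  let ?G = "doubling \<beta> J" and ?r = "replicate (prefix_value \<beta> p) (1::nat)"
  have IH: "derives ?G (N p) ?r" using Suc by simp
  have tail: "derives_list ?G (if \<beta> p then [T 1] else []) (replicate (of_bool (\<beta> p)) 1)"
    using derl_Cons[OF der_T derl_Nil, of ?G 1] derl_Nil[of ?G] by auto
  have "derives_list ?G ([N p, N p] @ (if \<beta> p then [T 1] else []))
      (?r @ ?r @ replicate (of_bool (\<beta> p)) 1)"
    using derl_Cons[OF IH derl_Cons[OF IH tail]] by simp
  also have "?r @ ?r @ replicate (of_bool (\<beta> p)) 1 = replicate (prefix_value \<beta> (Suc p)) 1"
    by (simp add: replicate_add[symmetric] mult_2 add.assoc)
  finally show ?case
    by (intro der_N[of _ _ "[N p, N p] @ (if \<beta> p then [T 1] else [])"])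
      (use Suc.prems in \<open>simp_all add: doubling_def\<close>)
qed

lemma derives_word: "derives (doubling \<beta> J) (N (2 * J + 1)) (word \<beta> J)"
proof -
  let ?G = "doubling \<beta> J"
  have "derives_list ?G (concat (map (\<lambda>p. [N p, T 2]) ps))
      (concat (map (\<lambda>v. replicate v 1 @ [2]) (map (prefix_value \<beta>) ps)))"
    if "set ps \<subseteq> {..2 * J}" for ps
    using that
  proof (induction ps)
    case Nil
    show ?case by (simp add: derl_Nil)
  next
    case (Cons p ps)
    then have "derives ?G (N p) (replicate (prefix_value \<beta> p) 1)" using derives_doubling by simp
    moreover have "derives_list ?G (concat (map (\<lambda>p. [N p, T 2]) ps))
      (concat (map (\<lambda>v. replicate v 1 @ [2]) (map (prefix_value \<beta>) ps)))" using Cons by simp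
    ultimately have "derives_list ?G (N p # T 2 # concat (map (\<lambda>p. [N p, T 2]) ps))
      (replicate (prefix_value \<beta> p) 1 @ [2] @ concat (map (\<lambda>v. replicate v 1 @ [2]) (map (prefix_value \<beta>) ps)))"
      by (intro derl_Cons der_T)
    then show ?case by simp
  qed
  moreover have "set [J + 1..<2 * J + 1] \<subseteq> {..2 * J}" by (auto simp del: upt_Suc)
  ultimately have "derives_list ?G (concat (map (\<lambda>p. [N p, T 2]) [J + 1..<2 * J + 1])) (word \<beta> J)"
    unfolding word_def exponents_def by blast
  moreover have "?G (2 * J + 1) = Some (concat (map (\<lambda>p. [N p, T 2]) [J + 1..<2 * J + 1]))"
    by (simp add: doubling_def del: upt_Suc)
  ultimately show ?thesis by (rule der_N[rotated])
qed

lemma is_slp_doubling: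
  assumes "J \<ge> 1"
  shows "is_slp (doubling \<beta> J) (2 * J + 1)"
proof -
  let ?G = "doubling \<beta> J"
  have less: "B < A" if "?G A = Some rhs" "N B \<in> set rhs" for A B rhs
    using that by (auto simp: doubling_def split: if_splits simp del: upt_Suc)
  have "{(A, B). \<exists>rhs. ?G A = Some rhs \<and> N B \<in> set rhs} \<subseteq> {(A, B). B < A}"
    using less by auto
  moreover have "acyclic {(A, B :: nat). B < A}"
    using wf_acyclic[OF wf_less] acyclic_converse[of "{(x, y :: nat). x < y}"] by (simp add: converse_unfold)
  ultimately have "acyclic {(A, B). \<exists>rhs. ?G A = Some rhs \<and> N B \<in> set rhs}"
    using acyclic_subset by blast
  moreover have "rhs \<noteq> []" if "?G A = Some rhs" for A rhs
  proof -
    have "J + 1 \<in> set [J + 1..<2 * J + 1]" using assms by (auto simp del: upt_Suc)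
    then show ?thesis using that unfolding doubling_def
      by (auto split: if_splits simp del: upt_Suc set_upt)
  qed
  moreover have "B \<in> dom ?G" if "?G A = Some rhs" "N B \<in> set rhs" for A B rhs
  proof -
    have "A \<in> dom ?G" using that by blast
    then show ?thesis using less[OF that] unfolding dom_doubling by simp
  qed
  ultimately show ?thesis unfolding is_slp_def by (auto simp: dom_doubling)
qed

lemma size_doubling: "slp_size (doubling \<beta> J) \<le> 8 * J + 3"
proof -
  let ?G = "doubling \<beta> J"
  have "slp_size ?G = (\<Sum>A\<le>2 * J. length (the (?G A))) + length (the (?G (2 * J + 1)))"
    unfolding slp_size_def dom_doubling by simp
  also have "(\<Sum>A\<le>2 * J. length (the (?G A))) \<le> (\<Sum>A\<le>2 * J. 3)"
    by (intro sum_mono) (auto simp: doubling_def)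
  also have "length (the (?G (2 * J + 1))) = 2 * J"
    by (simp add: doubling_def length_concat o_def sum_list_triv del: upt_Suc)
  finally show ?thesis by simp
qed

lemma g_word_bounds:
  assumes "J \<ge> 1"
  shows "0 < g (word \<beta> J)" "g (word \<beta> J) \<le> 8 * J + 3"
proof -
  let ?Q = "\<lambda>s. \<exists>P S. is_slp P S \<and> derives P (N S) (word \<beta> J) \<and> slp_size P = s"
  have Q: "?Q (slp_size (doubling \<beta> J))" using is_slp_doubling[OF assms] derives_word by blast
  show "g (word \<beta> J) \<le> 8 * J + 3"
    unfolding g_def using Least_le[of ?Q, OF Q] size_doubling by (rule order_trans)
  have "?Q (g (word \<beta> J))" unfolding g_def using LeastI[of ?Q, OF Q] .
  then obtain P S where PS: "is_slp P S" "slp_size P = g (word \<beta> J)" by blast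
  then have "finite (dom P)" "S \<in> dom P" by (auto simp: is_slp_def)
  then have "length (the (P S)) \<le> slp_size P" unfolding slp_size_def by (intro member_le_sum) auto
  moreover have "the (P S) \<noteq> []" using PS(1) by (auto simp: is_slp_def)
  ultimately show "0 < g (word \<beta> J)" using PS(2) by (cases "the (P S)") auto
qed

section \<open>The lower bound\<close>

lemma length_exponents: "length (exponents \<beta> J) = J"
  by (simp add: exponents_def del: upt_Suc)

lemma exponents_top:
  assumes "J \<ge> 1"
  shows "prefix_value \<beta> (2 * J) \<in> set (exponents \<beta> J)"
  unfolding exponents_def using assms by (auto simp del: upt_Suc)

lemma set_word: "set (word \<beta> J) \<subseteq> {1, 2}"
  by (auto simp: word_def simp del: upt_Suc)

lemma length_word: "length (word \<beta> J) = (\<Sum>v\<leftarrow>exponents \<beta> J. v + 1)"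
  by (simp add: word_def length_concat o_def)

text \<open>The largest exponent alone gives the lower bound, and \<open>J\<close> exponents below
  \<open>2 ^ (2 * J + 1)\<close> the upper one. Hence the logarithm of the length lies between
  \<open>2 * J\<close> and \<open>4 * J\<close>.\<close>

lemma length_word_bounds:
  assumes "J \<ge> 1"
  shows "2 ^ (2 * J) \<le> length (word \<beta> J)" "length (word \<beta> J) \<le> 2 ^ (4 * J)"
proof -
  have "2 ^ (2 * J) \<le> prefix_value \<beta> (2 * J) + 1" using prefix_value_bounds(1)[of "2 * J" \<beta>] by simp
  also have "\<dots> \<le> (\<Sum>v\<leftarrow>exponents \<beta> J. v + 1)"
    using exponents_top[OF assms, of \<beta>] by (intro member_le_sum_list) auto
  finally show "2 ^ (2 * J) \<le> length (word \<beta> J)" unfolding length_word .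
  have "v + 1 \<le> 2 ^ (2 * J + 1)" if "v \<in> set (exponents \<beta> J)" for v
  proof -
    obtain p where "v = prefix_value \<beta> p" "p \<le> 2 * J" using \<open>v \<in> _\<close>
      by (auto simp: exponents_def simp del: upt_Suc)
    moreover have "(2::nat) ^ Suc p \<le> 2 ^ (2 * J + 1)" using \<open>p \<le> 2 * J\<close> by (intro power_increasing) auto
    ultimately show ?thesis using prefix_value_bounds(2)[of \<beta> p] by linarith
  qed
  then have "(\<Sum>v\<leftarrow>exponents \<beta> J. v + 1) \<le> (\<Sum>v\<leftarrow>exponents \<beta> J. 2 ^ (2 * J + 1))"
    by (intro sum_list_mono)
  also have "\<dots> = J * 2 ^ (2 * J + 1)" by (simp add: sum_list_triv length_exponents)
  also have "\<dots> \<le> 2 ^ (2 * J - 1) * 2 ^ (2 * J + 1)"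
  proof (rule mult_right_mono)
    have "J < 2 ^ J" by (rule less_exp)
    also have "(2::nat) ^ J \<le> 2 ^ (2 * J - 1)" using assms by (intro power_increasing) auto
    finally show "J \<le> 2 ^ (2 * J - 1)" by simp
  qed simp
  also have "\<dots> = 2 ^ ((2 * J - 1) + (2 * J + 1))" by (simp only: power_add)
  also have "(2 * J - 1) + (2 * J + 1) = 4 * J" using assms by simp
  finally show "length (word \<beta> J) \<le> 2 ^ (4 * J)" unfolding length_word .
qed

lemma quadratic_less_power: "10 \<le> J \<Longrightarrow> 3 * (J * J) + 4 * J + 3 < (2::nat) ^ (J + 1)"
proof (induction J rule: nat_induct_at_least)
  case (Suc J)
  then have "10 * J \<le> J * J" by simp
  moreover have "3 * (Suc J * Suc J) + 4 * Suc J + 3 = 3 * (J * J) + 10 * J + 10" by simp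
  moreover have "(2::nat) ^ (Suc J + 1) = 2 * 2 ^ (J + 1)" by simp
  ultimately show ?case using Suc by linarith
qed simp

text \<open>The largest exponent alone suffices: it is at least \<open>2 ^ (2 * J)\<close>, so
  before each of the first \<open>J\<close> rounds it still accounts for at least
  \<open>2 ^ (J + 1)\<close> copies of the current letter, more than the quadratic
  threshold.\<close>

lemma exponents_dominate:
  assumes "10 \<le> J" "i < J"
  shows "(\<Sum>v\<leftarrow>exponents \<beta> J. v div 2 ^ i) > 3 * (length (exponents \<beta> J) * (i + 1)) + 4 * i + 3"
proof -
  have "3 * (J * (i + 1)) + 4 * i + 3 \<le> 3 * (J * J) + 4 * J + 3"
    using assms(2) by (intro add_mono mult_le_mono) auto
  also have "\<dots> < 2 ^ (J + 1)" by (rule quadratic_less_power[OF assms(1)])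
  also have "\<dots> \<le> (2::nat) ^ (2 * J - i)" using assms by (intro power_increasing) auto
  also have "\<dots> = 2 ^ (2 * J) div 2 ^ i" using assms by (simp add: power_diff)
  also have "\<dots> \<le> prefix_value \<beta> (2 * J) div 2 ^ i" by (intro div_le_mono prefix_value_bounds)
  also have "\<dots> \<le> (\<Sum>v\<leftarrow>exponents \<beta> J. v div 2 ^ i)"
    using exponents_top[of J \<beta>] assms by (intro member_le_sum_list) auto
  finally show ?thesis by (simp add: length_exponents)
qed

text \<open>There are \<open>J\<close> blocks, each with at least \<open>J div 4\<close> low
  letters. Windows of length \<open>2 * (2 * m + 4)\<close> identify positions of the pattern, so
  chunks of one letter more, that is of length \<open>4 * m + 9\<close>, are unique.\<close>

lemma repair_word_size:
  assumes J: "J = (m + 2) * 2 ^ m" "10 \<le> J" and P: "repair_result (word (pattern m) J) P"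
  shows "J * (J div 4 div (4 * m + 9)) \<le> slp_size P"
proof -
  let ?\<beta> = "pattern m"
  let ?vs = "exponents ?\<beta> J"
  have run: "repair_step\<^sup>*\<^sup>* [0 \<mapsto> map T (word ?\<beta> J)] P" "\<not> (\<exists>gm. maximal_string P gm)"
    using P by (auto simp: repair_result_def)
  have "stage ?vs 0 id [0 \<mapsto> map T (word ?\<beta> J)]" unfolding word_def by (rule stage_0)
  then obtain f Q where Q: "stage ?vs J f Q" "repair_step\<^sup>*\<^sup>* Q P"
    using forced_rounds[OF _ run exponents_dominate] J(2) by blast
  \<comment> \<open>The choice of \<open>J\<close> makes the positions below \<open>2 * J\<close>
    exactly those covered by \<open>pattern_window_unique\<close>.\<close>
  have "2 * J = (2 * m + 4) * 2 ^ m" using J(1) by (simp add: algebra_simps)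
  then have unique: "x = y"
    if "x < 2 * J" "y < 2 * J" "\<forall>t<2 * (2 * m + 4). ?\<beta> (x + t) = ?\<beta> (y + t)" for x y
    using pattern_window_unique that by metis
  have "(\<Sum>v\<leftarrow>?vs. J div 4 div (4 * m + 9)) \<le> (\<Sum>v\<leftarrow>?vs. length (low_part (letter f) J v) div (2 * (2 * m + 4) + 1))"
  proof (rule sum_list_mono)
    fix v assume "v \<in> set ?vs"
    then obtain p where "v = prefix_value ?\<beta> p" "J \<le> p" by (auto simp: exponents_def simp del: upt_Suc)
    then have "J div 4 \<le> length (low_part (letter f) J v)" using length_low_part pattern_dense by blast
    moreover have "2 * (2 * m + 4) + 1 = 4 * m + 9" by simp
    ultimately show "J div 4 div (4 * m + 9) \<le> length (low_part (letter f) J v) div (2 * (2 * m + 4) + 1)"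
      using div_le_mono by metis
  qed
  also have "\<dots> \<le> slp_size P"
    by (rule repair_size_lower_bound[OF Q unique]) auto
  finally show ?thesis by (simp add: sum_list_triv length_exponents)
qed

text \<open>The constant is \<open>1728 = 48 * 9 * 4\<close>, with the factors coming from
  \<open>J <= 48 * m * k\<close>, from \<open>g ?w <= 9 * J\<close> and from
  \<open>log 2 n <= 4 * J\<close>. The denominator comes from
  \<open>m <= log 2 (log 2 n)\<close>.\<close>

lemma repair_word_ratio:
  assumes J: "J = (m + 2) * 2 ^ m" and m: "5 \<le> m" and P: "repair_result (word (pattern m) J) P"
  defines "n \<equiv> length (word (pattern m) J)"
  shows "real (slp_size P) / real (g (word (pattern m) J))
    \<ge> 1 / 1728 * log 2 (real n) / log 2 (log 2 (real n))"
proof -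
  let ?w = "word (pattern m) J"
  define k where "k = J div 4 div (4 * m + 9)"
  have "(2::nat) ^ 5 \<le> 2 ^ m" using m by (intro power_increasing) auto
  \<comment> \<open>This makes \<open>J\<close> at least \<open>D = 16 * m + 36\<close>, so that the
    quotient \<open>k\<close> is positive and the floor costs at most a factor of two.\<close>
  then have J_ge: "J \<ge> (m + 2) * 32" unfolding J by (intro mult_le_mono) auto
  then have "64 \<le> J" by simp
  then have Jpos: "J \<ge> 1" "10 \<le> J" by linarith+
  have "2 ^ m \<le> J" unfolding J by simp
  define D where "D = 4 * (4 * m + 9)"
  have k: "k = J div D" unfolding k_def D_def by (simp only: div_mult2_eq)
  have "0 < D" "D \<le> J" unfolding D_def using J_ge by simp_all
  then have "1 \<le> k" unfolding k by (simp add: Suc_le_eq div_greater_zero_iff)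
  have "J < D + D * k" unfolding k by (rule dividend_less_times_div[OF \<open>0 < D\<close>])
  also have "\<dots> \<le> D * k + D * k" using \<open>1 \<le> k\<close> by simp
  also have "\<dots> = (2 * k) * (4 * (4 * m + 9))" unfolding D_def by simp
  \<comment> \<open>Here \<open>4 * m + 9 <= 6 * m\<close> follows from
    \<open>5 <= m\<close>.\<close>
  also have "\<dots> \<le> (2 * k) * (4 * (6 * m))" using m by (intro mult_le_mono) auto
  finally have "J < 48 * m * k" by (simp add: ac_simps)
  then have "real J \<le> 48 * real m * real k" by (metis less_imp_le of_nat_le_iff of_nat_mult of_nat_numeral)
  then have k_ge: "real J / (48 * real m) \<le> real k" using m by (simp add: field_simps)

  have "J * k \<le> slp_size P" unfolding k_def by (rule repair_word_size[OF J Jpos(2) P])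
  then have size: "real J * real k \<le> real (slp_size P)" by (metis of_nat_le_iff of_nat_mult)
  have g: "0 < g ?w" "g ?w \<le> 9 * J" using g_word_bounds[OF Jpos(1), of "pattern m"] Jpos(2) by linarith+
  then have "real (g ?w) \<le> 9 * real J" by (metis of_nat_le_iff of_nat_mult of_nat_numeral)
  then have "real J * real k / (9 * real J) \<le> real (slp_size P) / real (g ?w)"
    using size g(1) by (intro frac_le) auto
  then have "real k / 9 \<le> real (slp_size P) / real (g ?w)" using Jpos(1) by simp
  then have ratio: "real J / (432 * real m) \<le> real (slp_size P) / real (g ?w)" using k_ge by simp

  have n: "2 ^ (2 * J) \<le> real n" "real n \<le> 2 ^ (4 * J)"
    using length_word_bounds[OF Jpos(1), of "pattern m"] unfolding n_def
    by (metis of_nat_le_iff of_nat_numeral of_nat_power)+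
  have n_pos: "0 < real n" using n(1) by (meson less_le_trans zero_less_numeral zero_less_power)
  have "log 2 (real n) \<le> log 2 (2 ^ (4 * J))" using n(2) n_pos by (subst log_le_cancel_iff) auto
  then have log_le: "log 2 (real n) \<le> 4 * real J" by (simp add: log_nat_power)
  have "log 2 (2 ^ (2 * J)) \<le> log 2 (real n)" using n(1) n_pos by (subst log_le_cancel_iff) auto
  then have log_ge: "2 * real J \<le> log 2 (real n)" by (simp add: log_nat_power)
  have "real m = log 2 (2 ^ m)" by (simp add: log_nat_power)
  also have "\<dots> \<le> log 2 (log 2 (real n))"
  proof -
    have "(2::real) ^ m \<le> real J" using \<open>2 ^ m \<le> J\<close> by (metis of_nat_le_iff of_nat_numeral of_nat_power)
    then have "(2::real) ^ m \<le> log 2 (real n)" using log_ge by linarith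
    moreover have "0 < log 2 (real n)" using log_ge Jpos(1) by simp
    ultimately show ?thesis by (subst log_le_cancel_iff) auto
  qed
  finally have loglog: "real m \<le> log 2 (log 2 (real n))" .
  have "1 / 1728 * log 2 (real n) / log 2 (log 2 (real n)) \<le> (1 / 1728 * (4 * real J)) / real m"
    using log_le loglog m log_ge by (intro frac_le) auto
  also have "\<dots> = real J / (432 * real m)" by simp
  finally show ?thesis using ratio by linarith
qed

theorem theorem1:
  shows "\<exists>c::real. c > 0 \<and> (\<exists>\<^sub>\<infinity>n::nat. \<exists>w::nat list. length w = n \<and> set w \<subseteq> {1, 2}
     \<and> (\<exists>P. repair_result w P)
     \<and> (\<forall>P. repair_result w P \<longrightarrow>
          real (slp_size P) / real (g w) \<ge> c * log 2 (real n) / log 2 (log 2 (real n))))"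
proof (intro exI[of _ "1 / 1728"] conjI)
  show "\<exists>\<^sub>\<infinity>n::nat. \<exists>w::nat list. length w = n \<and> set w \<subseteq> {1, 2}
     \<and> (\<exists>P. repair_result w P)
     \<and> (\<forall>P. repair_result w P \<longrightarrow>
          real (slp_size P) / real (g w) \<ge> 1 / 1728 * log 2 (real n) / log 2 (log 2 (real n)))"
    unfolding frequently_cofinite infinite_nat_iff_unbounded_le mem_Collect_eq
  proof (intro allI)
    fix n0 :: nat
    \<comment> \<open>The summand \<open>n0\<close> makes the word longer than any given bound; the
      summand \<open>5\<close> meets the hypothesis of \<open>repair_word_ratio\<close>.\<close>
    define m J where "m = n0 + 5" and "J = (m + 2) * 2 ^ m"
    let ?w = "word (pattern m) J"
    have "m \<le> J" unfolding J_def by (metis le_add1 le_trans mult_le_mono2 nat_mult_1_right one_le_numeral one_le_power)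
    then have J: "n0 \<le> J" "J \<ge> 1" unfolding m_def by linarith+
    have len: "2 ^ (2 * J) \<le> length ?w" using length_word_bounds(1)[OF J(2)] .
    have "n0 \<le> 2 ^ (2 * J)" using J(1) less_exp[of "2 * J"] by linarith
    then have "n0 \<le> length ?w" using len by linarith
    moreover have "?w \<noteq> []" using len by (metis list.size(3) not_less zero_less_numeral zero_less_power)
    then have "wf_rules [0 \<mapsto> map T ?w]" by (simp add: wf_rules_def)
    then have "\<exists>P. repair_result ?w P" unfolding repair_result_def by (rule repair_terminates)
    moreover have "5 \<le> m" by (simp add: m_def)
    ultimately show "\<exists>n\<ge>n0. \<exists>w::nat list. length w = n \<and> set w \<subseteq> {1, 2}
     \<and> (\<exists>P. repair_result w P)
     \<and> (\<forall>P. repair_result w P \<longrightarrow>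
          real (slp_size P) / real (g w) \<ge> 1 / 1728 * log 2 (real n) / log 2 (log 2 (real n)))"
      using repair_word_ratio[OF J_def] set_word
      by (intro exI[of _ "length ?w"] conjI exI[of _ ?w]) auto
  qed
qed simp

end
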